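(* There is an absolute constant $C>0$ such that the following holds. Let $d\ge 0$ and $t\ge 1$ be integers, let $F\in\mathbb{R}[X,Y]$ be a nonzero polynomial of degree $d$, and let $G\in\mathbb{R}[X,Y]$ be a $t$-sparse polynomial. Then the set of real solutions $\{(x,y)\in\mathbb{R}^2 : F(x,y)=0,\ G(x,y)=0\}$ has at most $C(d^3t+d^2t^3)$ connected components; that is, the number of connected components is $O(d^3t+d^2t^3)$.
   Context: A polynomial is called $t$-sparse if it has at most $t$ monomials (i.e., it can be written as $\sum_{j=1}^t a_j X^{\alpha_j}Y^{\beta_j}$ with $a_j\in\mathbb{R}$ and $\alpha_j,\beta_j\in\mathbb{N}$). *)

theory Defs
  imports "HOL-Computational_Algebra.Polynomial" "HOL-Analysis.Analysis"
begin

(* Bivariate polynomials R[X,Y] are represented as R[X][Y], the type "real poly poly":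
   the coefficient of X^a Y^b in P is "coeff (coeff P b) a". *)

definition bipoly_eval :: "'a::comm_semiring_0 poly poly \<Rightarrow> 'a \<Rightarrow> 'a \<Rightarrow> 'a" where
  "bipoly_eval P x y = poly (poly P [:y:]) x"

definition bipoly_support :: "'a::zero poly poly \<Rightarrow> (nat \<times> nat) set" where
  "bipoly_support P = {(a, b). coeff (coeff P b) a \<noteq> 0}"

(* The zero polynomial gets total degree 0. *)
definition total_degree :: "'a::zero poly poly \<Rightarrow> nat" where
  "total_degree P = Max (insert 0 ((\<lambda>(a, b). a + b) ` bipoly_support P))"

definition t_sparse :: "nat \<Rightarrow> 'a::zero poly poly \<Rightarrow> bool" where
  "t_sparse t P \<longleftrightarrow> card (bipoly_support P) \<le> t"

lemma bipoly_support_subset: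
  "bipoly_support P \<subseteq> (SIGMA b:{..degree P}. {..degree (coeff P b)})\<inverse>"
  by (auto simp: bipoly_support_def intro!: le_degree)

lemma finite_bipoly_support: "finite (bipoly_support P)"
  by (rule finite_subset[OF bipoly_support_subset]) simp

lemma coeff_sum_monom_monom:
  "coeff (coeff (\<Sum>j\<in>A. monom (monom (c j) (\<alpha> j)) (\<beta> j)) b) a =
    (\<Sum>j\<in>A. if \<alpha> j = a \<and> \<beta> j = b then c j else 0)"
  unfolding coeff_sum by (rule sum.cong) auto

lemma bipoly_as_sum_of_monomials:
  fixes P :: "'a::comm_monoid_add poly poly"
  shows "P = (\<Sum>(a, b)\<in>bipoly_support P. monom (monom (coeff (coeff P b) a) a) b)"
proof (rule poly_eqI, rule poly_eqI)
  fix b a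
  have "coeff (coeff (\<Sum>p\<in>bipoly_support P.
      monom (monom (coeff (coeff P (snd p)) (fst p)) (fst p)) (snd p)) b) a =
    (\<Sum>p\<in>bipoly_support P. if p = (a, b) then coeff (coeff P b) a else 0)"
    unfolding coeff_sum_monom_monom by (rule sum.cong) auto
  also have "\<dots> = coeff (coeff P b) a"
    by (subst sum.delta[OF finite_bipoly_support]) (auto simp: bipoly_support_def)
  finally show "coeff (coeff P b) a = coeff (coeff (\<Sum>(a, b)\<in>bipoly_support P.
      monom (monom (coeff (coeff P b) a) a) b) b) a"
    by (simp add: case_prod_unfold)
qed

lemma bipoly_eval_eq_sum:
  fixes P :: "'a::comm_ring_1 poly poly"
  shows "bipoly_eval P x y = (\<Sum>(a, b)\<in>bipoly_support P. coeff (coeff P b) a * x ^ a * y ^ b)"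
proof -
  have "bipoly_eval P x y =
    bipoly_eval (\<Sum>(a, b)\<in>bipoly_support P. monom (monom (coeff (coeff P b) a) a) b) x y"
    by (rule arg_cong[where f = "\<lambda>Q. bipoly_eval Q x y", OF bipoly_as_sum_of_monomials])
  also have "\<dots> = (\<Sum>(a, b)\<in>bipoly_support P. coeff (coeff P b) a * x ^ a * y ^ b)"
    by (simp add: bipoly_eval_def poly_sum poly_monom poly_power case_prod_unfold)
  finally show ?thesis .
qed

lemma t_sparse_iff_sum_of_monomials:
  fixes P :: "'a::comm_monoid_add poly poly"
  shows "t_sparse t P \<longleftrightarrow>
    (\<exists>c \<alpha> \<beta>. P = (\<Sum>j=1..t. monom (monom (c j) (\<alpha> j)) (\<beta> j)))"
proof
  assume sp: "t_sparse t P"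
  define k where "k = card (bipoly_support P)"
  obtain h where h: "bij_betw h {1..k} (bipoly_support P)"
    using ex_bij_betw_nat_finite_1[OF finite_bipoly_support[of P]] by (auto simp: k_def)
  define c where "c j = (if j \<le> k then coeff (coeff P (snd (h j))) (fst (h j)) else 0)" for j
  have "P = (\<Sum>p\<in>bipoly_support P.
      monom (monom (coeff (coeff P (snd p)) (fst p)) (fst p)) (snd p))"
    using bipoly_as_sum_of_monomials[of P] unfolding case_prod_unfold .
  also have "\<dots> = (\<Sum>j=1..k. monom (monom (c j) (fst (h j))) (snd (h j)))"
    by (subst sum.reindex_bij_betw[OF h, symmetric]) (simp add: c_def)
  also have "\<dots> = (\<Sum>j=1..t. monom (monom (c j) (fst (h j))) (snd (h j)))"
    by (rule sum.mono_neutral_left) (use sp in \<open>auto simp: t_sparse_def k_def c_def\<close>)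
  finally have "P = (\<Sum>j=1..t. monom (monom (c j) ((fst \<circ> h) j)) ((snd \<circ> h) j))"
    by simp
  then show "\<exists>c \<alpha> \<beta>. P = (\<Sum>j=1..t. monom (monom (c j) (\<alpha> j)) (\<beta> j))"
    by blast
next
  assume "\<exists>c \<alpha> \<beta>. P = (\<Sum>j=1..t. monom (monom (c j) (\<alpha> j)) (\<beta> j))"
  then obtain c \<alpha> \<beta> where P: "P = (\<Sum>j=1..t. monom (monom (c j) (\<alpha> j)) (\<beta> j))"
    by blast
  have "bipoly_support P \<subseteq> (\<lambda>j. (\<alpha> j, \<beta> j)) ` {1..t}"
  proof (rule subrelI)
    fix a b assume "(a, b) \<in> bipoly_support P"
    then have "coeff (coeff P b) a \<noteq> 0" by (simp add: bipoly_support_def)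
    then have "(\<Sum>j=1..t. if \<alpha> j = a \<and> \<beta> j = b then c j else 0) \<noteq> 0"
      unfolding P coeff_sum_monom_monom .
    then obtain j where "j \<in> {1..t}" "(if \<alpha> j = a \<and> \<beta> j = b then c j else 0) \<noteq> 0"
      by (rule sum.not_neutral_contains_not_neutral)
    then show "(a, b) \<in> (\<lambda>j. (\<alpha> j, \<beta> j)) ` {1..t}"
      by (auto split: if_splits)
  qed
  then have "card (bipoly_support P) \<le> card {1..t}"
    by (rule surj_card_le[OF finite_atLeastAtMost])
  then show "t_sparse t P" by (simp add: t_sparse_def)
qed

end

theory Submission
  imports Defs "HOL-Computational_Algebra.Polynomial_Factorial"
    "HOL-Computational_Algebra.Field_as_Ring" "Jordan_Normal_Form.Determinant"
begin

text \<open>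
  It suffices to treat an irreducible \<open>F\<close>, because the zero set of a product is a union and the bound
  is superadditive in \<open>d\<close>. If \<open>F\<close> does not involve \<open>Y\<close> or divides \<open>Y\<close>, then \<open>G\<close> is restricted to
  lines, where it is a sparse univariate polynomial. Otherwise the curve \<open>F = 0\<close> is cut over
  \<open>O(d\<^sup>2)\<close> exceptional abscissae into \<open>O(d\<^sup>3)\<close>
  points and arcs, each arc a graph \<open>y = \<phi>(x)\<close> on which the derivation
  \<open>D = X Y (F\<^sub>Y \<partial>\<^sub>X - F\<^sub>X \<partial>\<^sub>Y)\<close> is a nonvanishing multiple of \<open>d/dx\<close>; this settles the case in which \<open>F\<close>
  divides \<open>G\<close>. When it does not, let
  \<open>W\<^sub>s\<close>, \<open>g\<^sub>s\<close> be the Wronskians with respect to \<open>D\<close> of \<open>f\<^sub>1, \<dots>, f\<^sub>s\<close> and of \<open>f\<^sub>1, \<dots>, f\<^sub>s, G\<close>, where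
  \<open>f\<^sub>1, \<dots>, f\<^sub>r\<close> is a maximal list of monomials of \<open>G\<close> such that \<open>F\<close> divides no \<open>W\<^sub>s\<close>; then \<open>F\<close> divides \<open>g\<^sub>r\<close>.
  Sylvester's identity gives \<open>D(g\<^sub>s / W\<^bsub>s+1\<^esub>) = W\<^sub>s g\<^bsub>s+1\<^esub> / W\<^bsub>s+1\<^esub>\<^sup>2\<close>, so by Rolle's theorem the zeros of \<open>g\<^sub>s\<close> on
  the arcs are controlled by the number of arcs and the zeros of \<open>W\<^sub>s\<close>, \<open>W\<^bsub>s+1\<^esub>\<close>, \<open>g\<^bsub>s+1\<^esub>\<close>. Descending from the first
  \<open>s\<close> with \<open>F\<close> dividing \<open>g\<^sub>s\<close> bounds the zeros of \<open>g\<^sub>0 = G\<close>. Up to a monomial factor, \<open>W\<^sub>s\<close> is a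
  polynomial of degree at most \<open>s\<^sup>2 d\<close>, so Bezout's bound leaves it \<open>O(d\<^sup>2 s\<^sup>2)\<close> zeros.
\<close>

section \<open>Bivariate polynomials\<close>

lemma bipoly_eval_simps [simp]:
  "bipoly_eval 0 x y = 0" "bipoly_eval 1 x y = (1::'a::comm_ring_1)"
  "bipoly_eval (P + Q) x y = bipoly_eval P x y + bipoly_eval Q x (y::'a)"
  "bipoly_eval (P - Q) x y = bipoly_eval P x y - bipoly_eval Q x y"
  "bipoly_eval (P * Q) x y = bipoly_eval P x y * bipoly_eval Q x y"
  "bipoly_eval (pCons c P) x y = poly c x + y * bipoly_eval P x y"
  by (simp_all add: bipoly_eval_def)

lemma bipoly_eval_sum [simp]:
  "bipoly_eval (\<Sum>i\<in>A. f i) x y = (\<Sum>i\<in>A. bipoly_eval (f i) x (y::'a::comm_ring_1))"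
  by (induction A rule: infinite_finite_induct) auto

lemma bipoly_eval_prod [simp]:
  "bipoly_eval (\<Prod>i\<in>A. f i) x y = (\<Prod>i\<in>A. bipoly_eval (f i) x (y::'a::comm_ring_1))"
  by (induction A rule: infinite_finite_induct) auto

lemma bipoly_eval_monom [simp]:
  "bipoly_eval (monom (monom c a) b) x y = c * x ^ a * (y::'a::comm_ring_1) ^ b"
  by (simp add: bipoly_eval_def poly_monom)

lemma bipoly_eval_smult_const [simp]:
  "bipoly_eval (Polynomial.smult [:c:] P) x y = c * bipoly_eval P x (y::'a::comm_ring_1)"
  by (simp add: bipoly_eval_def)

section \<open>Formal partial derivatives\<close>

definition dX :: "'a::{comm_semiring_1,semiring_no_zero_divisors} poly poly \<Rightarrow> 'a poly poly" where
  "dX P = map_poly pderiv P"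

abbreviation dY :: "'a::{comm_semiring_1,semiring_no_zero_divisors} poly poly \<Rightarrow> 'a poly poly" where
  "dY \<equiv> pderiv"

lemma coeff_dX [simp]: "coeff (dX P) n = pderiv (coeff P n)"
  by (simp add: dX_def coeff_map_poly)

lemma dX_simps [simp]:
  "dX 0 = 0" "dX (P + Q) = dX P + dX Q" "dX (pCons c P) = pCons (pderiv c) (dX P)"
  by (rule poly_eqI; simp add: pderiv_add coeff_pCons split: nat.splits)+

lemma pderiv_sum: "pderiv (\<Sum>i\<in>A. f i) = (\<Sum>i\<in>A. pderiv (f i))"
  for f :: "'b \<Rightarrow> 'a::idom poly"
  by (induction A rule: infinite_finite_induct) (auto simp: pderiv_add)

lemma dX_mult: "dX (P * Q) = dX P * Q + P * dX (Q :: 'a::idom poly poly)"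
  by (rule poly_eqI)
    (simp add: coeff_mult pderiv_mult sum.distrib pderiv_sum add.commute mult.commute[of "coeff Q _"])

lemma bipoly_eval_has_derivative:
  assumes "(u has_real_derivative u') (at t)" "(v has_real_derivative v') (at t)"
  shows "((\<lambda>t. bipoly_eval P (u t) (v t)) has_real_derivative
     bipoly_eval (dX P) (u t) (v t) * u' + bipoly_eval (dY P) (u t) (v t) * v') (at t)"
proof (induction P)
  case (pCons c P)
  have "((\<lambda>t. poly c (u t)) has_real_derivative poly (pderiv c) (u t) * u') (at t)"
    by (rule DERIV_chain2[OF poly_DERIV assms(1)])
  from DERIV_add[OF this DERIV_mult[OF assms(2) pCons(2)]]
  show ?case
    by (simp add: pderiv_pCons algebra_simps)
qed simp

lemma continuous_bipoly_eval [continuous_intros]: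
  assumes "continuous_on S f" "continuous_on S g"
  shows "continuous_on S (\<lambda>z. bipoly_eval P (f z) (g z :: real))"
  by (induction P) (auto intro!: continuous_intros assms)

section \<open>Total degree and its additivity\<close>

lemma total_degree_le_iff:
  "total_degree P \<le> n \<longleftrightarrow> (\<forall>a b. coeff (coeff P b) a \<noteq> 0 \<longrightarrow> a + b \<le> n)"
  unfolding total_degree_def
  by (subst Max_le_iff) (auto simp: finite_bipoly_support, auto simp: bipoly_support_def)

lemma coeff_total_degree: "total_degree P < a + b \<Longrightarrow> coeff (coeff P b) a = 0"
  using total_degree_le_iff[of P "total_degree P"] by force

text \<open>The substitution \<open>X \<mapsto> T, Y \<mapsto> Y T\<close> turns the total degree into the degree in \<open>T\<close>.\<close>
definition grading :: "'a::comm_ring_1 poly poly \<Rightarrow> 'a poly poly" where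
  "grading P = (\<Sum>b\<le>degree P. monom (monom 1 b) b * map_poly (\<lambda>c. [:c:]) (coeff P b))"

lemma coeff_coeff_grading:
  "coeff (coeff (grading P) n) b = (if b \<le> n then coeff (coeff P b) (n - b) else 0)"
proof -
  have "coeff (coeff (grading P) n) b = (\<Sum>k\<le>degree P. if b = k then
      (if k \<le> n then coeff (coeff P k) (n - k) else 0) else 0)"
    unfolding grading_def coeff_sum
    by (rule sum.cong) (auto simp: coeff_map_poly coeff_monom_mult coeff_pCons split: nat.splits)
  also have "\<dots> = (if b \<le> n then coeff (coeff P b) (n - b) else 0)"
    by (auto simp: coeff_eq_0)
  finally show ?thesis .
qed

lemma coeff_coeff_grading_add: "coeff (coeff (grading P) (a + b)) b = coeff (coeff P b) a"
  by (simp add: coeff_coeff_grading)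

lemma bipoly_eqI: "(\<And>a b. coeff (coeff P b) a = coeff (coeff Q b) a) \<Longrightarrow> P = Q"
  by (intro poly_eqI) auto

lemma grading_sum: "grading (\<Sum>i\<in>A. f i) = (\<Sum>i\<in>A. grading (f i))"
proof -
  have "grading (P + Q) = grading P + grading Q" for P Q :: "'a poly poly"
    by (rule bipoly_eqI) (simp add: coeff_coeff_grading)
  moreover have "grading 0 = (0 :: 'a poly poly)"
    by (simp add: grading_def)
  ultimately show ?thesis
    by (induction A rule: infinite_finite_induct) auto
qed

text \<open>On monomials, X^a Y^b goes to Y^b T^(a+b), which is visibly multiplicative; expanding
  both factors into monomials extends this by bilinearity.\<close>

lemma grading_mult: "grading (P * Q) = grading P * (grading Q :: 'a::idom poly poly)"
proof -
  have mon: "grading (monom (monom c a) b) = monom (monom c b) (a + b)" for c :: 'a and a b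
    by (rule bipoly_eqI) (auto simp: coeff_coeff_grading)
  define f where "f P p = monom (monom (coeff (coeff P (snd p)) (fst p)) (fst p)) (snd p)"
    for P :: "'a poly poly" and p
  have exp: "P = (\<Sum>p\<in>bipoly_support P. f P p)" for P :: "'a poly poly"
    using bipoly_as_sum_of_monomials[of P] by (simp add: f_def case_prod_unfold)
  have "P * Q = (\<Sum>p\<in>bipoly_support P \<times> bipoly_support Q. f P (fst p) * f Q (snd p))"
    by (subst (1) exp[of P], subst (1) exp[of Q]) (simp add: sum_product sum.cartesian_product case_prod_unfold)
  then have "grading (P * Q) = grading (\<Sum>p\<in>bipoly_support P \<times> bipoly_support Q. f P (fst p) * f Q (snd p))"
    by simp
  also have "\<dots> = (\<Sum>p\<in>bipoly_support P \<times> bipoly_support Q. grading (f P (fst p) * f Q (snd p)))"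
    by (rule grading_sum)
  also have "\<dots> = (\<Sum>p\<in>bipoly_support P \<times> bipoly_support Q. grading (f P (fst p)) * grading (f Q (snd p)))"
    by (simp add: f_def mult_monom mon algebra_simps)
  also have "\<dots> = grading (\<Sum>p\<in>bipoly_support P. f P p) * grading (\<Sum>p\<in>bipoly_support Q. f Q p)"
    by (simp add: grading_sum sum_product sum.cartesian_product case_prod_unfold)
  also have "\<dots> = grading P * grading Q"
    by (simp flip: exp)
  finally show ?thesis .
qed

lemma grading_eq_0_iff [simp]: "grading P = 0 \<longleftrightarrow> P = (0 :: 'a::comm_ring_1 poly poly)"
proof
  assume "grading P = 0"
  then show "P = 0"
    by (intro bipoly_eqI) (metis coeff_0 coeff_coeff_grading_add)
qed (simp add: grading_def)

text \<open>The coefficient of T^n collects exactly the terms of total degree n. Degree rules for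
  univariate polynomials over an integral domain thereby become rules for the total degree.\<close>

lemma total_degree_eq_degree_grading: "total_degree P = degree (grading (P :: 'a::comm_ring_1 poly poly))"
proof (rule antisym)
  show "total_degree P \<le> degree (grading P)"
    unfolding total_degree_le_iff
    by (metis coeff_coeff_grading_add coeff_0 le_degree)
  show "degree (grading P) \<le> total_degree P"
    by (rule degree_le, safe, rule poly_eqI) (auto simp: coeff_coeff_grading intro!: coeff_total_degree)
qed

lemma total_degree_mult:
  fixes P Q :: "'a::idom poly poly"
  shows "P \<noteq> 0 \<Longrightarrow> Q \<noteq> 0 \<Longrightarrow> total_degree (P * Q) = total_degree P + total_degree Q"
  by (simp add: total_degree_eq_degree_grading grading_mult degree_mult_eq)

lemma total_degree_mult_le: "total_degree (P * Q) \<le> total_degree P + total_degree (Q :: 'a::idom poly poly)"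
  by (simp add: total_degree_eq_degree_grading grading_mult degree_mult_le)

lemma total_degree_simps [simp]: "total_degree 0 = 0" "total_degree 1 = 0" "total_degree [:[:c:]:] = 0"
  by (simp_all add: le_zero_eq[symmetric] total_degree_le_iff coeff_pCons split: nat.splits del: le_zero_eq)

lemma total_degree_prod_le:
  "(\<And>i. i \<in> A \<Longrightarrow> total_degree (f i) \<le> k) \<Longrightarrow>
   total_degree (\<Prod>i\<in>A. f i) \<le> card A * k" for f :: "'b \<Rightarrow> 'a::idom poly poly"
proof (induction A rule: infinite_finite_induct)
  case (insert x F)
  have "total_degree (prod f (insert x F)) \<le> total_degree (f x) + total_degree (prod f F)"
    using insert by (simp add: total_degree_mult_le)
  also have "\<dots> \<le> k + card F * k"
    using insert by (intro add_mono) auto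
  finally show ?case using insert by simp
qed auto

lemma total_degree_sum_le:
  "(\<And>i. i \<in> A \<Longrightarrow> total_degree (f i) \<le> k) \<Longrightarrow> total_degree (\<Sum>i\<in>A. f i) \<le> k"
  for f :: "'b \<Rightarrow> 'a::comm_ring_1 poly poly"
  unfolding total_degree_le_iff coeff_sum
  by (meson sum.not_neutral_contains_not_neutral)

lemma total_degree_add_le: "total_degree P \<le> k \<Longrightarrow> total_degree Q \<le> k \<Longrightarrow> total_degree (P + Q) \<le> k"
  for P :: "'a::comm_ring_1 poly poly"
  unfolding total_degree_le_iff coeff_add by (metis add_0)

lemma total_degree_diff_le: "total_degree P \<le> k \<Longrightarrow> total_degree Q \<le> k \<Longrightarrow> total_degree (P - Q) \<le> k"
  for P :: "'a::comm_ring_1 poly poly"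
  unfolding total_degree_le_iff coeff_diff by (metis diff_0_right)

lemma total_degree_monom_le: "total_degree (monom (monom c a) b) \<le> a + b"
  by (auto simp: total_degree_le_iff)

lemma total_degree_smult_const_le: "total_degree (Polynomial.smult [:c:] P) \<le> total_degree P"
  for P :: "'a::comm_ring_1 poly poly"
  unfolding total_degree_le_iff[of "Polynomial.smult [:c:] P"]
  by (auto intro!: leI dest: coeff_total_degree)

lemma total_degree_dY_le: "total_degree (dY P) \<le> total_degree P - 1"
  for P :: "'a::idom poly poly"
  unfolding total_degree_le_iff[of "dY P"]
proof (safe, rule ccontr)
  fix a b assume "coeff (coeff (dY P) b) a \<noteq> 0" "\<not> a + b \<le> total_degree P - 1"
  moreover from this(2) have "coeff (coeff P (Suc b)) a = 0"
    by (intro coeff_total_degree) auto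
  ultimately show False by (simp add: coeff_pderiv of_nat_poly)
qed

lemma total_degree_dX_le: "total_degree (dX P) \<le> total_degree P - 1"
  for P :: "'a::idom poly poly"
  unfolding total_degree_le_iff[of "dX P"]
proof (safe, rule ccontr)
  fix a b assume "coeff (coeff (dX P) b) a \<noteq> 0" "\<not> a + b \<le> total_degree P - 1"
  moreover from this(2) have "coeff (coeff P b) (Suc a) = 0"
    by (intro coeff_total_degree) auto
  ultimately show False by (simp add: coeff_pderiv)
qed

lemma degree_le_total_degree: "degree P \<le> total_degree P"
proof (cases "P = 0")
  case False
  then have "coeff (coeff P (degree P)) (degree (coeff P (degree P))) \<noteq> 0" by simp
  then show ?thesis by (metis coeff_total_degree leI add.commute trans_less_add1)
qed simp

lemma degree_coeff_le_total_degree: "degree (coeff P b) \<le> total_degree P"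
proof (cases "coeff P b = 0")
  case False
  then have "coeff (coeff P b) (degree (coeff P b)) \<noteq> 0" by simp
  then show ?thesis by (metis coeff_total_degree leI trans_less_add1)
qed simp

lemma total_degree_eq_0_iff: "total_degree P = 0 \<longleftrightarrow> (\<exists>c. P = [:[:c:]:])"
proof
  assume "total_degree P = 0"
  then have "degree P = 0" "degree (coeff P 0) = 0"
    using degree_le_total_degree[of P] degree_coeff_le_total_degree[of P 0] by auto
  then show "\<exists>c. P = [:[:c:]:]"
    by (metis degree_0_id degree_eq_zeroE coeff_pCons_0)
qed auto

lemma bipoly_is_unit_iff: "is_unit P \<longleftrightarrow> P \<noteq> 0 \<and> total_degree P = 0"
  for P :: "real poly poly"
proof
  assume "is_unit P"
  then obtain Q where Q: "1 = P * Q" by (rule dvdE)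
  then have "P \<noteq> 0" "Q \<noteq> 0" by auto
  with total_degree_mult[OF this] Q show "P \<noteq> 0 \<and> total_degree P = 0"
    by (metis total_degree_simps(2) add_is_0)
next
  assume P: "P \<noteq> 0 \<and> total_degree P = 0"
  then obtain c where "P = [:[:c:]:]" using total_degree_eq_0_iff by blast
  with P show "is_unit P" by (auto simp: is_unit_const_poly_iff dvd_field_iff)
qed

text \<open>Unique factorization in R[X,Y], by Gauss's lemma. Bezout's bound below is stated for
  prime elements.\<close>

lemma irreducible_imp_prime_bipoly: "irreducible P \<Longrightarrow> prime_elem P" for P :: "real poly poly"
  by (rule irreducible_imp_prime_elem)

section \<open>Bezout's bound\<close>

interpretation bipoly: vector_space "\<lambda>c P. Polynomial.smult [:c:] (P :: real poly poly)"
  by unfold_locales (simp_all add: smult_add_right smult_add_left[symmetric] mult.commute one_pCons[symmetric])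

section \<open>Linear dependence and dimension counts\<close>

context vector_space
begin

text \<open>Stated for an indexed family because vectors may repeat: a repetition gives a relation
  with coefficients 1 and -1, and an injective family is dependent by dimension.\<close>

lemma ex_dependency_of_card_less:
  assumes J: "finite J" and B: "finite B" and v: "v ` J \<subseteq> span B" and less: "card B < card J"
  shows "\<exists>c. (\<exists>j\<in>J. c j \<noteq> 0) \<and> (\<Sum>j\<in>J. scale (c j) (v j)) = 0"
proof (cases "inj_on v J")
  case True
  have "dependent (v ` J)"
  proof (rule ccontr)
    assume "\<not> dependent (v ` J)"
    from independent_span_bound[OF B this v] True less show False
      by (simp add: card_image)
  qed
  then obtain u where "\<exists>w\<in>v ` J. u w \<noteq> 0" "(\<Sum>w\<in>v ` J. scale (u w) w) = 0"
    using J by (auto simp: dependent_finite)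
  with True show ?thesis
    by (intro exI[of _ "u \<circ> v"]) (auto simp: sum.reindex)
next
  case False
  then obtain i j where ij: "i \<in> J" "j \<in> J" "i \<noteq> j" "v i = v j"
    by (auto simp: inj_on_def)
  define c :: "_ \<Rightarrow> 'a" where "c k = (if k = i then 1 else if k = j then -1 else 0)" for k
  have "(\<Sum>k\<in>J. scale (c k) (v k)) = (\<Sum>k\<in>{i,j}. scale (c k) (v k))"
    by (rule sum.mono_neutral_right) (use J ij in \<open>auto simp: c_def\<close>)
  also have "\<dots> = 0" using ij by (simp add: c_def)
  finally show ?thesis using ij by (intro exI[of _ c]) (auto simp: c_def)
qed

end

definition monomials_upto :: "nat \<Rightarrow> (nat \<times> nat) set" where
  "monomials_upto k = {(a, b). a + b \<le> k}"

lemma finite_monomials_upto [simp]: "finite (monomials_upto k)"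
  by (rule finite_subset[of _ "{..k} \<times> {..k}"]) (auto simp: monomials_upto_def)

text \<open>Degree k + 1 adds an antidiagonal of k + 2 exponents. The factor 2 avoids division in
  the naturals.\<close>

lemma card_monomials_upto: "2 * card (monomials_upto k) = (k + 1) * (k + 2)"
proof (induction k)
  case 0
  have "monomials_upto 0 = {(0, 0)}" by (auto simp: monomials_upto_def)
  then show ?case by simp
next
  case (Suc k)
  have "monomials_upto (Suc k) = monomials_upto k \<union> (\<lambda>b. (Suc k - b, b)) ` {..Suc k}"
    by (auto simp: monomials_upto_def image_iff)
  moreover have "monomials_upto k \<inter> (\<lambda>b. (Suc k - b, b)) ` {..Suc k} = {}"
    by (auto simp: monomials_upto_def)
  moreover have "card ((\<lambda>b. (Suc k - b, b)) ` {..Suc k}) = k + 2"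
    by (subst card_image) (auto simp: inj_on_def)
  ultimately have "card (monomials_upto (Suc k)) = card (monomials_upto k) + (k + 2)"
    by (simp add: card_Un_disjoint)
  with Suc show ?case by (simp add: algebra_simps)
qed

definition mono_poly :: "nat \<times> nat \<Rightarrow> real poly poly" where
  "mono_poly p = monom (monom 1 (fst p)) (snd p)"

lemma coeff_mono_poly_combination:
  assumes "finite M"
  shows "coeff (coeff (\<Sum>p\<in>M. Polynomial.smult [:c p:] (mono_poly p)) b) a =
    (if (a, b) \<in> M then c (a, b) else 0)"
proof -
  have "coeff (coeff (\<Sum>p\<in>M. Polynomial.smult [:c p:] (mono_poly p)) b) a =
      (\<Sum>p\<in>M. if (a, b) = p then c p else 0)"
    unfolding coeff_sum by (rule sum.cong) (auto simp: mono_poly_def)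
  with assms show ?thesis by simp
qed

lemma total_degree_mono_poly_combination:
  "M \<subseteq> monomials_upto k \<Longrightarrow> total_degree (\<Sum>p\<in>M. Polynomial.smult [:c p:] (mono_poly p)) \<le> k"
  by (subst total_degree_le_iff, subst coeff_mono_poly_combination)
     (auto intro: finite_subset[OF _ finite_monomials_upto], auto simp: monomials_upto_def)

lemma in_span_mono_poly:
  assumes "total_degree P \<le> k"
  shows "P \<in> bipoly.span (mono_poly ` monomials_upto k)"
proof -
  have "P = (\<Sum>p\<in>bipoly_support P. Polynomial.smult [:coeff (coeff P (snd p)) (fst p):] (mono_poly p))"
    by (rule bipoly_eqI, subst coeff_mono_poly_combination)
       (rule finite_bipoly_support, auto simp: bipoly_support_def)
  also have "\<dots> \<in> bipoly.span (mono_poly ` monomials_upto k)"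
    using assms
    by (intro bipoly.span_sum bipoly.span_scale bipoly.span_base)
       (auto simp: monomials_upto_def bipoly_support_def total_degree_le_iff)
  finally show ?thesis .
qed

lemma degree_coeff_grading_le: "degree (coeff (grading P) n) \<le> n"
  by (rule degree_le) (simp add: coeff_coeff_grading)

text \<open>The leading monomial of \<open>F\<close> for the graded order divides that of each multiple of \<open>F\<close>.\<close>
lemma leading_monomial_multiple:
  fixes F :: "real poly poly"
  defines "\<beta> \<equiv> degree (lead_coeff (grading F))"
  assumes "F \<noteq> 0" "K \<noteq> 0"
  shows "\<exists>(a, b) \<in> monomials_upto (total_degree K).
    coeff (coeff (F * K) (b + \<beta>)) (a + (total_degree F - \<beta>)) \<noteq> 0"
proof -
  define \<kappa> where "\<kappa> = degree (lead_coeff (grading K))"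
  have le: "\<beta> \<le> total_degree F" "\<kappa> \<le> total_degree K"
    unfolding \<beta>_def \<kappa>_def total_degree_eq_degree_grading by (rule degree_coeff_grading_le)+
  \<comment> \<open>The leading coefficients of the gradings are the top-degree forms, with Y as
    remaining variable; their own leading coefficients are nonzero and multiply without
    cancellation.\<close>
  have "coeff (coeff (grading (F * K)) (total_degree F + total_degree K)) (\<beta> + \<kappa>) \<noteq> 0"
    using assms
    by (simp add: grading_mult total_degree_eq_degree_grading coeff_mult_degree_sum \<beta>_def \<kappa>_def)
  then have "coeff (coeff (F * K) (\<beta> + \<kappa>)) (total_degree F + total_degree K - (\<beta> + \<kappa>)) \<noteq> 0"
    by (simp add: coeff_coeff_grading split: if_splits)
  moreover have "total_degree F + total_degree K - (\<beta> + \<kappa>) = (total_degree K - \<kappa>) + (total_degree F - \<beta>)"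
    using le by simp
  ultimately have "coeff (coeff (F * K) (\<kappa> + \<beta>)) ((total_degree K - \<kappa>) + (total_degree F - \<beta>)) \<noteq> 0"
    by (simp only: add.commute[of \<beta>] not_False_eq_True)
  moreover have "(total_degree K - \<kappa>, \<kappa>) \<in> monomials_upto (total_degree K)"
    using le by (simp add: monomials_upto_def)
  ultimately show ?thesis
    by blast
qed

text \<open>A product of lines, one through each other point \<open>w\<close>: the vertical line
  when the abscissae of \<open>w\<close> and \<open>z\<close> differ, and otherwise the horizontal
  one, so that none passes through \<open>z\<close>.\<close>

lemma ex_separating_bipoly:
  fixes z :: "real \<times> real"
  assumes "finite Z"
  shows "\<exists>L. total_degree L \<le> card Z \<and> bipoly_eval L (fst z) (snd z) \<noteq> 0 \<and>
    (\<forall>w\<in>Z - {z}. bipoly_eval L (fst w) (snd w) = 0)"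
proof -
  define l where "l w = (if fst z \<noteq> fst w then [:[:- fst w, 1:]:] else [:[:- snd w:], 1:])"
    for w :: "real \<times> real"
  define L where "L = (\<Prod>w\<in>Z - {z}. l w)"
  have "total_degree L \<le> card (Z - {z}) * 1"
    unfolding L_def
    by (rule total_degree_prod_le)
       (auto simp: l_def total_degree_le_iff coeff_pCons split: nat.splits)
  also have "\<dots> \<le> card Z"
    using assms by (simp add: card_mono)
  finally have "total_degree L \<le> card Z" .
  moreover have "bipoly_eval L (fst z) (snd z) \<noteq> 0"
    unfolding L_def using assms by (auto simp: l_def prod_eq_iff)
  moreover have "bipoly_eval L (fst w) (snd w) = 0" if "w \<in> Z - {z}" for w
    unfolding L_def using assms that by (auto simp: l_def intro!: bexI[of _ w])
  ultimately show ?thesis by blast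
qed

text \<open>A dimension count in degree at most \<open>m\<close>: the products of \<open>F\<close> with monomials, those of \<open>T\<close> with
  the monomials not divisible by the leading monomial of \<open>F\<close>, and polynomials separating the points
  of \<open>Z\<close> are linearly independent.\<close>
lemma bezout_finite_subset:
  fixes F T :: "real poly poly"
  assumes F: "prime_elem F" and T: "\<not> F dvd T" and Z: "finite Z"
    and zero: "\<And>x y. (x, y) \<in> Z \<Longrightarrow> bipoly_eval F x y = 0 \<and> bipoly_eval T x y = 0"
  shows "card Z \<le> total_degree F * total_degree T"
proof -
  define d e N where "d = total_degree F" and "e = total_degree T" and "N = card Z"
  \<comment> \<open>Large enough to contain the three families of the count, and to make the
    truncated differences \<open>m - d\<close>, \<open>m - e\<close> and \<open>m - e - d\<close>
    exact.\<close>
  define m where "m = d + e + N"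
  have nz: "F \<noteq> 0" "T \<noteq> 0" using F T by auto
  have "\<forall>z\<in>Z. \<exists>L. total_degree L \<le> N \<and> bipoly_eval L (fst z) (snd z) \<noteq> 0 \<and>
      (\<forall>w\<in>Z - {z}. bipoly_eval L (fst w) (snd w) = 0)"
    unfolding N_def using ex_separating_bipoly[OF Z] by blast
  then obtain L where L: "\<And>z. z \<in> Z \<Longrightarrow> total_degree (L z) \<le> N"
      "\<And>z. z \<in> Z \<Longrightarrow> bipoly_eval (L z) (fst z) (snd z) \<noteq> 0"
      "\<And>z w. z \<in> Z \<Longrightarrow> w \<in> Z \<Longrightarrow> w \<noteq> z \<Longrightarrow> bipoly_eval (L z) (fst w) (snd w) = 0"
    by (metis Diff_iff empty_iff insert_iff)
  define \<beta> where "\<beta> = degree (lead_coeff (grading F))"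
  \<comment> \<open>The exponents of degree at most \<open>m - e\<close> divisible by the leading
    monomial of \<open>F\<close>, whose exponents are \<open>d - \<beta>\<close> and
    \<open>\<beta>\<close>.\<close>
  define sh where "sh = (\<lambda>(a, b). (a + (d - \<beta>), b + \<beta>)) ` monomials_upto (m - e - d)"
  have \<beta>: "\<beta> \<le> d" unfolding \<beta>_def d_def total_degree_eq_degree_grading by (rule degree_coeff_grading_le)
  define M where "M = monomials_upto (m - d)"
  define M' where "M' = monomials_upto (m - e) - sh"
  have fin: "finite M" "finite M'" "finite sh" by (auto simp: M_def M'_def sh_def)
  have sh_sub: "sh \<subseteq> monomials_upto (m - e)"
    using \<beta> by (auto simp: sh_def monomials_upto_def m_def)
  have "card sh = card (monomials_upto (m - e - d))"
    unfolding sh_def by (rule card_image) (auto simp: inj_on_def)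
  then have card_M': "card M' + card (monomials_upto (m - e - d)) = card (monomials_upto (m - e))"
    unfolding M'_def using sh_sub fin card_Diff_subset[OF fin(3) sh_sub] card_mono[OF _ sh_sub] by simp
  define v where "v = case_sum (\<lambda>p. F * mono_poly p) (case_sum (\<lambda>p. T * mono_poly p) L)"
  define J where "J = M <+> (M' <+> Z)"
  define B where "B = mono_poly ` monomials_upto m"
  have "\<not> card B < card J"
  proof
    assume "card B < card J"
    have "total_degree (mono_poly p) \<le> k" if "p \<in> monomials_upto k" for p k
      using that total_degree_monom_le[of "1::real" "fst p" "snd p"]
      by (auto simp: mono_poly_def monomials_upto_def)
    note mono_le = this
    have "total_degree (F * mono_poly p) \<le> m" if "p \<in> M" for p
      using mono_le[of p "m - d"] that total_degree_mult_le[of F "mono_poly p"]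
      by (simp add: M_def d_def m_def)
    moreover have "total_degree (T * mono_poly p) \<le> m" if "p \<in> M'" for p
      using mono_le[of p "m - e"] that total_degree_mult_le[of T "mono_poly p"]
      by (simp add: M'_def e_def m_def)
    moreover have "total_degree (L z) \<le> m" if "z \<in> Z" for z
      using L(1)[OF that] by (simp add: m_def)
    ultimately have "v ` J \<subseteq> bipoly.span B"
      unfolding B_def J_def v_def by (auto intro!: in_span_mono_poly)
    then obtain c where c: "\<exists>j\<in>J. c j \<noteq> 0" "(\<Sum>j\<in>J. Polynomial.smult [:c j:] (v j)) = 0"
      using bipoly.ex_dependency_of_card_less[of J B v] \<open>card B < card J\<close> fin Z
      by (auto simp: J_def B_def)
    define A where "A = (\<Sum>p\<in>M. Polynomial.smult [:c (Inl p):] (mono_poly p))"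
    define A' where "A' = (\<Sum>p\<in>M'. Polynomial.smult [:c (Inr (Inl p)):] (mono_poly p))"
    define R where "R = (\<Sum>z\<in>Z. Polynomial.smult [:c (Inr (Inr z)):] (L z))"
    have eq: "F * A + T * A' + R = 0"
      using c(2) fin Z unfolding J_def v_def A_def A'_def R_def
      by (simp add: sum.Plus sum_distrib_left algebra_simps)
    \<comment> \<open>Evaluation at \<open>z\<close> kills \<open>F\<close>, \<open>T\<close> and
      every separating polynomial except that of \<open>z\<close> itself.\<close>
    have cZ: "c (Inr (Inr z)) = 0" if z: "z \<in> Z" for z
    proof -
      have "bipoly_eval (F * A + T * A' + R) (fst z) (snd z) = 0" by (simp add: eq)
      then have "(\<Sum>w\<in>Z. c (Inr (Inr w)) * bipoly_eval (L w) (fst z) (snd z)) = 0"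
        using zero[of "fst z" "snd z"] z by (simp add: R_def)
      also have "(\<Sum>w\<in>Z. c (Inr (Inr w)) * bipoly_eval (L w) (fst z) (snd z)) =
          (\<Sum>w\<in>Z. if w = z then c (Inr (Inr z)) * bipoly_eval (L z) (fst z) (snd z) else 0)"
        by (rule sum.cong) (use L(3) z in auto)
      finally show ?thesis using L(2)[OF z] z Z by simp
    qed
    then have "R = 0" by (simp add: R_def)
    with eq have TA': "F * A + T * A' = 0" by simp
    \<comment> \<open>Primality makes \<open>F\<close> divide \<open>A'\<close>. If
      \<open>A'\<close> were nonzero, it would contain a multiple of the leading monomial of
      \<open>F\<close>, an exponent in \<open>sh\<close>, but \<open>A'\<close> is supported on
      \<open>M'\<close>, outside \<open>sh\<close>.\<close>
    have "A' = 0"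
    proof (rule ccontr)
      assume "A' \<noteq> 0"
      have "T * A' = F * (- A)" using TA' by (simp add: add_eq_0_iff)
      then have "F dvd T * A'" by (metis dvd_triv_left)
      then have "F dvd A'" using F T prime_elem_dvd_mult_iff by blast
      then obtain K where K: "A' = F * K" by (rule dvdE)
      with \<open>A' \<noteq> 0\<close> have "K \<noteq> 0" by auto
      have "total_degree A' \<le> m - e"
        unfolding A'_def by (rule total_degree_mono_poly_combination) (auto simp: M'_def)
      then have "total_degree K \<le> m - e - d"
        using total_degree_mult[OF nz(1) \<open>K \<noteq> 0\<close>] K by (simp add: d_def)
      obtain a b where ab: "a + b \<le> total_degree K" "coeff (coeff A' (b + \<beta>)) (a + (d - \<beta>)) \<noteq> 0"
        using leading_monomial_multiple[OF nz(1) \<open>K \<noteq> 0\<close>] unfolding K \<beta>_def d_def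
        by (auto simp: monomials_upto_def)
      then have "(a + (d - \<beta>), b + \<beta>) \<in> M'"
        using fin unfolding A'_def by (subst (asm) coeff_mono_poly_combination) (auto split: if_splits)
      moreover have "(a + (d - \<beta>), b + \<beta>) \<in> sh"
        unfolding sh_def using ab(1) \<open>total_degree K \<le> m - e - d\<close>
        by (intro image_eqI[of _ _ "(a, b)"]) (auto simp: monomials_upto_def)
      ultimately show False by (simp add: M'_def)
    qed
    moreover from this TA' nz have "A = 0" by simp
    ultimately have "c (Inl p) = 0" if "p \<in> M" for p
      using coeff_mono_poly_combination[OF fin(1), of "c \<circ> Inl" "snd p" "fst p"] that
      by (simp add: A_def)
    moreover have "c (Inr (Inl p)) = 0" if "p \<in> M'" for p
      using coeff_mono_poly_combination[OF fin(2), of "c \<circ> Inr \<circ> Inl" "snd p" "fst p"] that \<open>A' = 0\<close>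
      by (simp add: A'_def)
    ultimately show False
      using c(1) cZ by (auto simp: J_def)
  qed
  moreover have "card J = card M + (card M' + N)"
    using fin Z by (simp add: J_def N_def card_Plus)
  moreover have "card B \<le> card (monomials_upto m)"
    unfolding B_def by (rule card_image_le) simp
  ultimately have "card M + (card M' + N) \<le> card (monomials_upto m)" by simp
  then have "card M + card (monomials_upto (m - e)) + N \<le>
      card (monomials_upto m) + card (monomials_upto (m - e - d))"
    using card_M' by simp
  then have "2 * card M + 2 * card (monomials_upto (m - e)) + 2 * N \<le>
      2 * card (monomials_upto m) + 2 * card (monomials_upto (m - e - d))"
    by linarith
  then have "(e + N + 1) * (e + N + 2) + (d + N + 1) * (d + N + 2) + 2 * N \<le>
      (d + e + N + 1) * (d + e + N + 2) + (N + 1) * (N + 2)"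
    unfolding M_def card_monomials_upto by (simp add: m_def)
  \<comment> \<open>The mixed second difference of (x + 1)(x + 2) with steps d and e is 2 d e, so
    the inequality collapses to 2 N at most 2 d e.\<close>
  then have "N \<le> d * e" by (simp add: algebra_simps)
  then show ?thesis by (simp add: N_def d_def e_def)
qed

text \<open>The bound on finite subsets is uniform, and this forces the whole zero set to be
  finite.\<close>

theorem bezout:
  fixes F T :: "real poly poly"
  assumes F: "prime_elem F" and T: "\<not> F dvd T"
  defines "Z \<equiv> {(x, y). bipoly_eval F x y = 0 \<and> bipoly_eval T x y = 0}"
  shows "finite Z" "card Z \<le> total_degree F * total_degree T"
proof -
  have "card Y \<le> total_degree F * total_degree T" if "finite Y" "Y \<subseteq> Z" for Y
    by (rule bezout_finite_subset[OF F T]) (use that in \<open>auto simp: Z_def\<close>)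
  then show "finite Z" "card Z \<le> total_degree F * total_degree T"
    using finite_if_finite_subsets_card_bdd[of Z "total_degree F * total_degree T"] by blast+
qed

section \<open>Wronskians for a derivation\<close>

lemma det_mat_cong:
  "(\<And>i j. i < n \<Longrightarrow> j < n \<Longrightarrow> f i j = g i j) \<Longrightarrow>
   det (mat n n (\<lambda>(i, j). f i j)) = det (mat n n (\<lambda>(i, j). g i j))"
  by (rule arg_cong[where f = det]) (auto intro!: eq_matI)

lemma det_mat_eq_sum:
  "det (mat n n (\<lambda>(i, j). f i j)) =
     (\<Sum>p | p permutes {0..<n}. signof p * (\<Prod>i = 0..<n. f i (p i)))"
proof -
  have "p i < n" if "p permutes {0..<n}" "i < n" for p i
    using permutes_in_image[OF that(1), of i] that(2) by simp
  then show ?thesis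
    by (subst det_def'[of _ n]) (auto intro!: sum.cong prod.cong)
qed

lemma det_mat_scale_columns:
  "det (mat n n (\<lambda>(i, j). m j * f i j)) = (\<Prod>j<n. m j) * det (mat n n (\<lambda>(i, j). f i j))"
proof -
  have "(\<Prod>i = 0..<n. m (p i)) = (\<Prod>j<n. m j)" if "p permutes {0..<n}" for p
    using prod.permute[OF that, of m] by (simp add: atLeast0LessThan o_def)
  then show ?thesis
    unfolding det_mat_eq_sum sum_distrib_left
    by (intro sum.cong) (auto simp: prod.distrib)
qed

lemma total_degree_det_le:
  fixes f :: "nat \<Rightarrow> nat \<Rightarrow> 'a::idom poly poly"
  assumes "\<And>i j. i < n \<Longrightarrow> j < n \<Longrightarrow> total_degree (f i j) \<le> k"
  shows "total_degree (det (mat n n (\<lambda>(i, j). f i j))) \<le> n * k"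
  unfolding det_mat_eq_sum
proof (rule total_degree_sum_le)
  fix p assume "p \<in> {p. p permutes {0..<n}}"
  then have p: "p permutes {0..<n}" by simp
  have "p i < n" if "i < n" for i
    using permutes_in_image[OF p, of i] that by simp
  then have "total_degree (\<Prod>i = 0..<n. f i (p i)) \<le> n * k"
    using total_degree_prod_le[of "{0..<n}" "\<lambda>i. f i (p i)" k] assms by simp
  moreover have "total_degree (- P) = total_degree P" for P :: "'a poly poly"
    by (simp add: total_degree_def bipoly_support_def)
  ultimately show "total_degree (signof p * (\<Prod>i = 0..<n. f i (p i))) \<le> n * k"
    by (simp add: sign_def)
qed

lemma det_1x1: "det (mat 1 1 (\<lambda>(i, j). f i j)) = f 0 0"
  by (subst det_single) auto

lemma det_2x2: "det (mat 2 2 (\<lambda>(i, j). f i j)) = f 0 0 * f 1 1 - f 0 1 * (f 1 0 :: 'a::comm_ring_1)"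
  by (subst laplace_expansion_column[of _ 2 0])
     (auto simp: numeral_2_eq_2 cofactor_def mat_delete_def det_single)

text \<open>The columns past \<open>n\<close> are eliminated by multiplying with the block matrix
  \<open>(1, - adj A U; 0, det A)\<close>, which needs no division. The cases \<open>k = 1\<close> and \<open>k = 2\<close> yield
  Sylvester's identity.\<close>
lemma det_bordered_blocks:
  fixes g :: "nat \<Rightarrow> nat \<Rightarrow> 'a::idom" and n k :: nat
  defines "A \<equiv> mat n n (\<lambda>(i, j). g i j)"
  assumes A0: "det A \<noteq> 0"
  shows "det (mat (n + k) (n + k) (\<lambda>(i, j). g i j)) * det A ^ k =
    det A * det (mat k k (\<lambda>(i, j). det A * g (n + i) (n + j) -
      (\<Sum>l<n. g (n + i) l * (\<Sum>m<n. adj_mat A $$ (l, m) * g m (n + j)))))"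
proof -
  define U where "U = mat n k (\<lambda>(i, j). g i (n + j))"
  define C where "C = mat k n (\<lambda>(i, j). g (n + i) j)"
  define E where "E = mat k k (\<lambda>(i, j). g (n + i) (n + j))"
  define Z where "Z = four_block_mat (1\<^sub>m n) (- (adj_mat A * U)) (0\<^sub>m k n) (det A \<cdot>\<^sub>m 1\<^sub>m k)"
  have carr: "A \<in> carrier_mat n n" "U \<in> carrier_mat n k" "C \<in> carrier_mat k n" "E \<in> carrier_mat k k"
    by (auto simp: A_def U_def C_def E_def)
  note adj = adj_mat[OF carr(1)]
  have AU: "adj_mat A * U \<in> carrier_mat n k" using adj carr by simp
  have M: "mat (n + k) (n + k) (\<lambda>(i, j). g i j) = four_block_mat A U C E"
    by (rule eq_matI) (auto simp: A_def U_def C_def E_def)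
  have detZ: "det Z = det A ^ k"
    unfolding Z_def
    by (subst det_four_block_mat_lower_left_zero[of _ n _ k]) (use AU in auto)
  define S where "S = det A \<cdot>\<^sub>m E - C * (adj_mat A * U)"
  have S: "S \<in> carrier_mat k k" unfolding S_def
    by (intro minus_carrier_mat mult_carrier_mat[of _ k n] carr AU)
  have "A * (- (adj_mat A * U)) + U * (det A \<cdot>\<^sub>m 1\<^sub>m k) = 0\<^sub>m n k"
  proof -
    have "A * (adj_mat A * U) = det A \<cdot>\<^sub>m U"
      using adj carr
      by (simp add: assoc_mult_mat[symmetric, of _ n n _ n _ k] mult_smult_assoc_mat[of _ n n])
    moreover have "U * (det A \<cdot>\<^sub>m 1\<^sub>m k) = det A \<cdot>\<^sub>m U"
      using carr by (simp add: mult_smult_distrib[of _ n k _ k])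
    moreover have "A * (- (adj_mat A * U)) = - (A * (adj_mat A * U))"
      by (rule uminus_mult_right_mat) (simp only: carrier_matD[OF carr(1)] carrier_matD[OF carr(3)] carrier_matD[OF AU])
    ultimately show ?thesis
      using uminus_l_inv_mat[of "det A \<cdot>\<^sub>m U" n k] carr(2) by simp
  qed
  note z1 = this
  have z2: "C * (- (adj_mat A * U)) + E * (det A \<cdot>\<^sub>m 1\<^sub>m k) = S"
  proof -
    have "E * (det A \<cdot>\<^sub>m 1\<^sub>m k) = det A \<cdot>\<^sub>m E"
      using carr by (simp add: mult_smult_distrib[of _ k k _ k])
    moreover have "C * (- (adj_mat A * U)) = - (C * (adj_mat A * U))"
      by (rule uminus_mult_right_mat) (simp only: carrier_matD[OF carr(1)] carrier_matD[OF carr(3)] carrier_matD[OF AU])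
    moreover have "- Y + W = W - Y" if "Y \<in> carrier_mat k k" "W \<in> carrier_mat k k" for Y W :: "'a mat"
      using that by (auto intro!: eq_matI)
    ultimately show ?thesis
      using mult_carrier_mat[OF carr(3) AU] carr(4) by (simp add: S_def)
  qed
  have "four_block_mat A U C E * Z = four_block_mat
      (A * 1\<^sub>m n + U * 0\<^sub>m k n) (A * (- (adj_mat A * U)) + U * (det A \<cdot>\<^sub>m 1\<^sub>m k))
      (C * 1\<^sub>m n + E * 0\<^sub>m k n) (C * (- (adj_mat A * U)) + E * (det A \<cdot>\<^sub>m 1\<^sub>m k))"
    unfolding Z_def
    by (rule mult_four_block_mat[of _ n n _ k _ k _ _ n _ k])
      (use carr AU in \<open>simp_all only: uminus_carrier_iff_mat zero_carrier_mat one_carrier_mat smult_carrier_mat\<close>)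
  also have "\<dots> = four_block_mat A (0\<^sub>m n k) C S"
    unfolding z1 z2 using carr by simp
  finally have "four_block_mat A U C E * Z = four_block_mat A (0\<^sub>m n k) C S" .
  moreover have "det (four_block_mat A U C E * Z) = det (four_block_mat A U C E) * det Z"
    by (rule det_mult[of _ "n + k"]) (use carr AU in \<open>auto simp: Z_def\<close>)
  moreover have "det (four_block_mat A (0\<^sub>m n k) C S) = det A * det S"
    by (rule det_four_block_mat_upper_right_zero[of _ n _ k]) (use carr S in auto)
  moreover have "S = mat k k (\<lambda>(i, j). det A * g (n + i) (n + j) -
      (\<Sum>l<n. g (n + i) l * (\<Sum>m<n. adj_mat A $$ (l, m) * g m (n + j))))"
    unfolding S_def using carr AU adj(1)
    by (auto intro!: eq_matI sum.cong simp: scalar_prod_def C_def E_def U_def atLeast0LessThan)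
  ultimately show ?thesis
    by (simp add: M detZ)
qed

text \<open>Bordering by one row and column computes each entry \<open>s i j\<close> of a 2 by 2
  matrix, and bordering by two computes its determinant. The surplus powers of \<open>det A\<close>
  cancel because the ring is a domain.\<close>

lemma sylvester_identity:
  fixes g :: "nat \<Rightarrow> nat \<Rightarrow> 'a::idom" and n :: nat
  defines "b \<equiv> \<lambda>i j. det (mat (n + 1) (n + 1)
    (\<lambda>(x, y). g (if x < n then x else n + i) (if y < n then y else n + j)))"
  assumes A0: "det (mat n n (\<lambda>(i, j). g i j)) \<noteq> 0"
  shows "det (mat (n + 2) (n + 2) (\<lambda>(i, j). g i j)) * det (mat n n (\<lambda>(i, j). g i j)) =
    b 0 0 * b 1 1 - b 0 1 * b 1 0"
proof -
  define A where "A = mat n n (\<lambda>(i, j). g i j)"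
  define s where "s i j = det A * g (n + i) (n + j) -
      (\<Sum>l<n. g (n + i) l * (\<Sum>m<n. adj_mat A $$ (l, m) * g m (n + j)))" for i j
  have b: "b i j = s i j" for i j
  proof -
    define h where "h x y = g (if x < n then x else n + i) (if y < n then y else n + j)" for x y
    have hA: "mat n n (\<lambda>(i, j). h i j) = A"
      by (auto intro!: eq_matI simp: h_def A_def)
    have "det (mat (n + 1) (n + 1) (\<lambda>(i, j). h i j)) * det A ^ 1 = det A * (det A * h n n -
      (\<Sum>l<n. h n l * (\<Sum>m<n. adj_mat A $$ (l, m) * h m n)))"
      using det_bordered_blocks[where g = h and n = n and k = 1] A0
      unfolding hA det_1x1 by (simp add: A_def)
    then show ?thesis using A0 by (simp add: b_def s_def h_def flip: A_def)
  qed
  have "det (mat (n + 2) (n + 2) (\<lambda>(i, j). g i j)) * det A ^ 2 =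
      det A * (s 0 0 * s 1 1 - s 0 1 * s 1 0)"
    using det_bordered_blocks[where g = g and n = n and k = 2] A0
    by (simp add: det_2x2 s_def flip: A_def)
  then show ?thesis using A0 by (simp add: b power2_eq_square flip: A_def)
qed

section \<open>Wronskians of an abstract derivation\<close>

locale derivation =
  fixes D :: "'a::idom \<Rightarrow> 'a"
  assumes add: "D (a + b) = D a + D b"
    and mult: "D (a * b) = D a * b + a * D b"
begin

lemma zero [simp]: "D 0 = 0"
  using add[of 0 0] by (metis add_0 add_right_cancel)

lemma one [simp]: "D 1 = 0"
  using mult[of 1 1] by (metis add_0 add_right_cancel mult_1 mult.right_neutral)

lemma minus: "D (- a) = - D a"
  using add[of a "- a"] by (simp add: eq_neg_iff_add_eq_0 add.commute)

lemma sum: "D (\<Sum>i\<in>A. f i) = (\<Sum>i\<in>A. D (f i))"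
  by (induction A rule: infinite_finite_induct) (auto simp: add)

lemma prod:
  "finite A \<Longrightarrow> D (\<Prod>i\<in>A. f i) = (\<Sum>k\<in>A. \<Prod>i\<in>A. if i = k then D (f i) else f i)"
proof (induction A rule: finite_induct)
  case (insert x A)
  have "(\<Prod>i\<in>A. if i = x then D (f i) else f i) = (\<Prod>i\<in>A. f i)"
    using insert by (intro prod.cong) auto
  moreover have "(\<Sum>k\<in>A. \<Prod>i\<in>insert x A. if i = k then D (f i) else f i) =
      f x * (\<Sum>k\<in>A. \<Prod>i\<in>A. if i = k then D (f i) else f i)"
    unfolding sum_distrib_left using insert by (intro sum.cong) auto
  ultimately show ?case
    using insert by (simp add: mult algebra_simps)
qed simp

lemma det:
  "D (det (mat n n (\<lambda>(i, j). f i j))) =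
   (\<Sum>k<n. det (mat n n (\<lambda>(i, j). if i = k then D (f i j) else f i j)))"
proof -
  have "D (signof p * a) = signof p * D a" for p :: "nat \<Rightarrow> nat" and a
    by (simp add: sign_def minus)
  then have "D (det (mat n n (\<lambda>(i, j). f i j))) = (\<Sum>p | p permutes {0..<n}. signof p *
      (\<Sum>k<n. \<Prod>i = 0..<n. if i = k then D (f i (p i)) else f i (p i)))"
    by (simp add: det_mat_eq_sum sum prod atLeast0LessThan)
  also have "\<dots> = (\<Sum>k<n. \<Sum>p | p permutes {0..<n}. signof p *
      (\<Prod>i = 0..<n. if i = k then D (f i (p i)) else f i (p i)))"
    unfolding sum_distrib_left by (rule sum.swap)
  finally show ?thesis by (simp add: det_mat_eq_sum)
qed

definition wronskian :: "'a list \<Rightarrow> 'a" where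
  "wronskian fs = det (mat (length fs) (length fs) (\<lambda>(i, j). (D ^^ i) (fs ! j)))"

lemma wronskian_Nil [simp]: "wronskian [] = 1"
  by (simp add: wronskian_def det_dim_zero)

text \<open>Differentiating any row but the last produces a copy of the next row, so only the term
  with the last row differentiated survives; that row then holds derivatives of order
  \<open>Suc n\<close> in place of \<open>n\<close>.\<close>

lemma derivation_wronskian:
  assumes "length fs = Suc n"
  shows "D (wronskian fs) = det (mat (Suc n) (Suc n)
    (\<lambda>(i, j). (D ^^ (if i < n then i else Suc n)) (fs ! j)))"
proof -
  define f where "f k i j = (if i = k then D ((D ^^ i) (fs ! j)) else (D ^^ i) (fs ! j))" for k i j
  have "D (wronskian fs) = (\<Sum>k<Suc n. det (mat (Suc n) (Suc n) (\<lambda>(i, j). f k i j)))"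
    unfolding wronskian_def det assms f_def by simp
  also have "\<dots> = (\<Sum>k<Suc n. if k = n then det (mat (Suc n) (Suc n) (\<lambda>(i, j). f n i j)) else 0)"
  proof (intro sum.cong refl)
    fix k assume "k \<in> {..<Suc n}"
    have "det (mat (Suc n) (Suc n) (\<lambda>(i, j). f k i j)) = 0" if "k < n"
      by (rule det_identical_rows[of _ "Suc n" k "Suc k"])
         (use that in \<open>auto simp: f_def intro!: eq_vecI\<close>)
    with \<open>k \<in> _\<close> show "det (mat (Suc n) (Suc n) (\<lambda>(i, j). f k i j)) =
        (if k = n then det (mat (Suc n) (Suc n) (\<lambda>(i, j). f n i j)) else 0)"
      by auto
  qed
  also have "\<dots> = det (mat (Suc n) (Suc n) (\<lambda>(i, j). f n i j))"
    by simp
  also have "\<dots> = det (mat (Suc n) (Suc n)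
    (\<lambda>(i, j). (D ^^ (if i < n then i else Suc n)) (fs ! j)))"
    by (rule det_mat_cong) (auto simp: f_def less_Suc_eq)
  finally show ?thesis .
qed

text \<open>Sylvester's identity for the last two rows and columns: bordering by the row of order n
  gives a Wronskian, and bordering by the row of order n + 1 gives its derivative. The right-hand
  side is the numerator of the derivative of a quotient of Wronskians.\<close>

lemma wronskian_identity:
  assumes "wronskian hs \<noteq> 0"
  shows "wronskian (hs @ [f, g]) * wronskian hs =
    wronskian (hs @ [f]) * D (wronskian (hs @ [g])) - wronskian (hs @ [g]) * D (wronskian (hs @ [f]))"
proof -
  define n where "n = length hs"
  define m where "m i j = (D ^^ i) ((hs @ [f, g]) ! j)" for i j
  have hs: "wronskian hs = det (mat n n (\<lambda>(i, j). m i j))"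
    unfolding wronskian_def n_def[symmetric] m_def
    by (rule det_mat_cong) (simp add: nth_append n_def)
  have w2: "wronskian (hs @ [f, g]) = det (mat (n + 2) (n + 2) (\<lambda>(i, j). m i j))"
    unfolding wronskian_def m_def n_def by simp
  have w0: "wronskian (hs @ [h]) = det (mat (n + 1) (n + 1)
      (\<lambda>(x, y). m (if x < n then x else n + 0) (if y < n then y else n + k)))"
    if "h = (hs @ [f, g]) ! (n + k)" for h k
    unfolding wronskian_def length_append list.size n_def[symmetric]
    by (simp, rule det_mat_cong) (auto simp: m_def that nth_append less_Suc_eq n_def)
  have w1: "D (wronskian (hs @ [h])) = det (mat (n + 1) (n + 1)
      (\<lambda>(x, y). m (if x < n then x else n + 1) (if y < n then y else n + k)))"
    if "h = (hs @ [f, g]) ! (n + k)" for h k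
    unfolding derivation_wronskian[of "hs @ [h]" n, unfolded length_append n_def[symmetric], simplified]
    by (simp, rule det_mat_cong) (auto simp: m_def that nth_append less_Suc_eq n_def)
  have f: "f = (hs @ [f, g]) ! (n + 0)" and g: "g = (hs @ [f, g]) ! (n + 1)"
    by (simp_all add: nth_append n_def)
  have "wronskian (hs @ [f, g]) * wronskian hs =
      wronskian (hs @ [f]) * D (wronskian (hs @ [g])) - wronskian (hs @ [g]) * D (wronskian (hs @ [f]))"
    using sylvester_identity[of n m, folded hs, OF assms]
    unfolding w2 w1[OF f] w1[OF g] unfolding w0[OF f] w0[OF g] .
  then show ?thesis .
qed

text \<open>Laplace expansion along the last column. Its cofactors do not involve \<open>g\<close>,
  so they may be computed with the placeholder 0 in the last position.\<close>

lemma wronskian_append_eq_sum: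
  "\<exists>\<kappa>. \<forall>g. wronskian (hs @ [g]) = (\<Sum>i\<le>length hs. (D ^^ i) g * \<kappa> i)"
proof -
  define n where "n = length hs"
  define M where "M g = mat (Suc n) (Suc n) (\<lambda>(i, j). (D ^^ i) ((hs @ [g]) ! j))" for g
  define \<kappa> where "\<kappa> i = cofactor (M 0) i n" for i
  have "wronskian (hs @ [g]) = (\<Sum>i\<le>n. (D ^^ i) g * \<kappa> i)" for g
  proof -
    have "wronskian (hs @ [g]) = det (M g)" by (simp add: wronskian_def M_def n_def)
    also have "\<dots> = (\<Sum>i<Suc n. M g $$ (i, n) * cofactor (M g) i n)"
      by (rule laplace_expansion_column) (auto simp: M_def)
    also have "\<dots> = (\<Sum>i<Suc n. (D ^^ i) g * \<kappa> i)"
    proof (intro sum.cong refl)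
      fix i assume "i \<in> {..<Suc n}"
      moreover have "mat_delete (M g) i n = mat_delete (M 0) i n"
        by (rule eq_matI) (auto simp: mat_delete_def M_def nth_append n_def)
      ultimately show "M g $$ (i, n) * cofactor (M g) i n = (D ^^ i) g * \<kappa> i"
        by (simp add: \<kappa>_def cofactor_def M_def nth_append n_def)
    qed
    finally show ?thesis by (simp add: lessThan_Suc_atMost)
  qed
  then show ?thesis unfolding n_def by blast
qed

lemma wronskian_append_eq_0:
  assumes "g \<in> set hs"
  shows "wronskian (hs @ [g]) = 0"
proof -
  obtain k where k: "k < length hs" "g = hs ! k" using assms by (auto simp: in_set_conv_nth)
  show ?thesis
    unfolding wronskian_def
    by (rule det_identical_columns[of _ "Suc (length hs)" k "length hs"])
       (use k in \<open>auto simp: nth_append intro!: eq_vecI\<close>)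
qed

end

section \<open>The vector field tangent to the curve\<close>

abbreviation varX :: "real poly poly" where "varX \<equiv> [:[:0, 1:]:]"
abbreviation varY :: "real poly poly" where "varY \<equiv> [:0, 1:]"

text \<open>Owing to the factor \<open>X Y\<close>, the derivative of a monomial is that monomial times a polynomial of
  degree at most \<open>total_degree F\<close>.\<close>
definition hamD :: "real poly poly \<Rightarrow> real poly poly \<Rightarrow> real poly poly" where
  "hamD F P = varX * varY * (dY F * dX P - dX F * dY P)"

interpretation ham: derivation "hamD F" for F
proof
  have *: "v * (A * (P' * Q + P * Q') - B * (P * Q'' + Q * P'')) =
      v * (A * P' - B * P'') * Q + P * (v * (A * Q' - B * Q''))"
    for v A B P P' P'' Q Q' Q'' :: "real poly poly"
    by (simp add: ring_distribs mult_ac)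
  show "hamD F (P * Q) = hamD F P * Q + P * hamD F Q" for P Q
    unfolding hamD_def dX_mult pderiv_mult by (rule *)
  show "hamD F (P + Q) = hamD F P + hamD F Q" for P Q
    by (simp only: hamD_def dX_simps pderiv_add ring_distribs)
qed

lemma bipoly_eval_hamD:
  "bipoly_eval (hamD F P) x y = x * y * (bipoly_eval (dY F) x y * bipoly_eval (dX P) x y
     - bipoly_eval (dX F) x y * bipoly_eval (dY P) x y)"
  by (simp add: hamD_def del: mult_pCons_left)

lemma hamD_const [simp]: "hamD F [:[:c:]:] = 0"
  by (simp add: hamD_def)

lemma hamD_smult: "hamD F (Polynomial.smult [:c:] P) = Polynomial.smult [:c:] (hamD F P)"
  using ham.mult[of F "[:[:c:]:]" P] by simp

lemma hamD_funpow_smult: "(hamD F ^^ i) (Polynomial.smult [:c:] P) = Polynomial.smult [:c:] ((hamD F ^^ i) P)"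
  by (induction i) (auto simp: hamD_smult)

lemma hamD_funpow_sum: "(hamD F ^^ i) (\<Sum>p\<in>M. f p) = (\<Sum>p\<in>M. (hamD F ^^ i) (f p))"
  by (induction i) (auto simp: ham.sum)

lemma total_degree_varX: "total_degree varX \<le> 1" and total_degree_varY: "total_degree varY \<le> 1"
  by (auto simp: total_degree_le_iff coeff_pCons split: nat.splits)

lemma total_degree_hamD:
  assumes "total_degree F \<ge> 1" "total_degree P \<le> k"
  shows "total_degree (hamD F P) \<le> total_degree F + k"
\<comment> \<open>For constant \<open>P\<close> the truncated \<open>total_degree P - 1\<close>
  would make the general estimate one too large; there the derivative is 0.\<close>
proof (cases "total_degree P = 0")
  case True
  then show ?thesis by (auto simp: total_degree_eq_0_iff)
next
  case False
  have "total_degree (dY F * dX P) \<le> (total_degree F - 1) + (total_degree P - 1)"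
    by (rule order.trans[OF total_degree_mult_le add_mono[OF total_degree_dY_le total_degree_dX_le]])
  moreover have "total_degree (dX F * dY P) \<le> (total_degree F - 1) + (total_degree P - 1)"
    by (rule order.trans[OF total_degree_mult_le add_mono[OF total_degree_dX_le total_degree_dY_le]])
  ultimately have *: "total_degree (dY F * dX P - dX F * dY P) \<le> (total_degree F - 1) + (total_degree P - 1)"
    by (rule total_degree_diff_le)
  have "total_degree (varX * varY) \<le> 1 + 1"
    by (rule order.trans[OF total_degree_mult_le add_mono[OF total_degree_varX total_degree_varY]])
  then have "total_degree (hamD F P) \<le> (1 + 1) + ((total_degree F - 1) + (total_degree P - 1))"
    unfolding hamD_def by (rule order.trans[OF total_degree_mult_le add_mono[OF _ *]])
  with False assms show ?thesis by simp
qed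

text \<open>The logarithmic derivative of the monomial m with exponents \<open>p\<close>, that is,
  \<open>hamD F\<close> of m divided by m.\<close>

definition logder :: "real poly poly \<Rightarrow> nat \<times> nat \<Rightarrow> real poly poly" where
  "logder F p = Polynomial.smult [:of_nat (fst p):] (varY * dY F) -
     Polynomial.smult [:of_nat (snd p):] (varX * dX F)"

text \<open>The quotient of the i-th iterated derivative of a monomial by that monomial; the
  recursion is the product rule.\<close>

fun logder_pow :: "real poly poly \<Rightarrow> nat \<times> nat \<Rightarrow> nat \<Rightarrow> real poly poly" where
  "logder_pow F p 0 = 1"
| "logder_pow F p (Suc i) = logder_pow F p i * logder F p + hamD F (logder_pow F p i)"

lemma varX_dX_mono: "varX * dX (mono_poly p) = Polynomial.smult [:of_nat (fst p):] (mono_poly p)"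
  by (rule bipoly_eqI) (auto simp: mono_poly_def coeff_pderiv coeff_pCons split: nat.splits)

lemma varY_dY_mono: "varY * dY (mono_poly p) = Polynomial.smult [:of_nat (snd p):] (mono_poly p)"
  by (rule bipoly_eqI) (auto simp: mono_poly_def coeff_pderiv coeff_pCons of_nat_poly split: nat.splits)

lemma hamD_mono: "hamD F (mono_poly p) = mono_poly p * logder F p"
proof -
  have "hamD F (mono_poly p) = varY * dY F * (varX * dX (mono_poly p)) -
      varX * dX F * (varY * dY (mono_poly p))"
    unfolding hamD_def by (simp only: ring_distribs mult_ac)
  then show ?thesis
    unfolding varX_dX_mono varY_dY_mono logder_def by (simp add: algebra_simps)
qed

lemma hamD_funpow_mono: "(hamD F ^^ i) (mono_poly p) = mono_poly p * logder_pow F p i"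
  by (induction i) (simp_all add: ham.mult hamD_mono algebra_simps)

lemma total_degree_logder_pow:
  assumes "total_degree F \<ge> 1"
  shows "total_degree (logder_pow F p i) \<le> i * total_degree F"
proof (induction i)
  case (Suc i)
  have "total_degree (varY * dY F) \<le> 1 + (total_degree F - 1)"
    by (rule order.trans[OF total_degree_mult_le add_mono[OF total_degree_varY total_degree_dY_le]])
  moreover have "total_degree (varX * dX F) \<le> 1 + (total_degree F - 1)"
    by (rule order.trans[OF total_degree_mult_le add_mono[OF total_degree_varX total_degree_dX_le]])
  ultimately have "total_degree (logder F p) \<le> total_degree F"
    unfolding logder_def using assms
    by (intro total_degree_diff_le order.trans[OF total_degree_smult_const_le]) auto
  then have "total_degree (logder_pow F p i * logder F p) \<le> i * total_degree F + total_degree F"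
    by (rule order.trans[OF total_degree_mult_le add_mono[OF Suc]])
  then show ?case
    using total_degree_hamD[OF assms Suc] by (simp add: total_degree_add_le add.commute)
qed simp

text \<open>Each column is its monomial times the polynomials \<open>logder_pow\<close>. Pulling the
  monomials out leaves a factor whose degree depends on the number of monomials and on
  \<open>F\<close>, but not on the exponents.\<close>

lemma wronskian_monomials:
  assumes "total_degree F \<ge> 1"
  shows "\<exists>T. ham.wronskian F (map mono_poly ps) = (\<Prod>j<length ps. mono_poly (ps ! j)) * T \<and>
    total_degree T \<le> length ps * (length ps * total_degree F)"
proof (intro exI conjI)
  let ?T = "det (mat (length ps) (length ps) (\<lambda>(i, j). logder_pow F (ps ! j) i))"
  have "ham.wronskian F (map mono_poly ps) =
      det (mat (length ps) (length ps) (\<lambda>(i, j). mono_poly (ps ! j) * logder_pow F (ps ! j) i))"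
    unfolding ham.wronskian_def length_map
    by (rule det_mat_cong) (simp add: hamD_funpow_mono)
  then show "ham.wronskian F (map mono_poly ps) = (\<Prod>j<length ps. mono_poly (ps ! j)) * ?T"
    by (simp add: det_mat_scale_columns)
  show "total_degree ?T \<le> length ps * (length ps * total_degree F)"
  proof (rule total_degree_det_le)
    fix i j assume "i < length ps"
    then show "total_degree (logder_pow F (ps ! j) i) \<le> length ps * total_degree F"
      by (intro order.trans[OF total_degree_logder_pow[OF assms]] mult_right_mono) auto
  qed
qed

text \<open>The Wronskian is linear over the reals in its last entry, since constants pass through
  the derivation.\<close>

lemma wronskian_append_dvd:
  assumes G: "G = (\<Sum>p\<in>M. Polynomial.smult [:c p:] (mono_poly p))"
    and dvd: "\<And>p. p \<in> M \<Longrightarrow> F dvd ham.wronskian F (hs @ [mono_poly p])"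
  shows "F dvd ham.wronskian F (hs @ [G])"
proof -
  obtain \<kappa> where \<kappa>: "\<And>g. ham.wronskian F (hs @ [g]) = (\<Sum>i\<le>length hs. (hamD F ^^ i) g * \<kappa> i)"
    using ham.wronskian_append_eq_sum[of F hs] by blast
  have "ham.wronskian F (hs @ [G]) =
      (\<Sum>i\<le>length hs. \<Sum>p\<in>M. Polynomial.smult [:c p:] ((hamD F ^^ i) (mono_poly p) * \<kappa> i))"
    unfolding \<kappa> G by (simp add: hamD_funpow_sum hamD_funpow_smult sum_distrib_right)
  also have "\<dots> = (\<Sum>p\<in>M. Polynomial.smult [:c p:] (ham.wronskian F (hs @ [mono_poly p])))"
    unfolding \<kappa> by (subst sum.swap) (simp add: bipoly.scale_sum_right)
  also have "F dvd \<dots>"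
    by (intro dvd_sum dvd_smult dvd)
  finally show ?thesis .
qed

text \<open>A longest list of distinct monomials all of whose prefixes have a Wronskian not
  divisible by \<open>F\<close>. Appending any monomial of \<open>G\<close> then gives divisibility,
  by maximality or by a repeated column, and linearity passes this on to \<open>G\<close>. The
  condition on all prefixes serves the step-by-step descent later.\<close>

lemma ex_maximal_independent_monomials:
  assumes F: "prime_elem F" and M: "finite M"
    and G: "G = (\<Sum>p\<in>M. Polynomial.smult [:c p:] (mono_poly p))"
  obtains ps where "length ps \<le> card M"
    "\<And>s. s \<le> length ps \<Longrightarrow> \<not> F dvd ham.wronskian F (map mono_poly (take s ps))"
    "F dvd ham.wronskian F (map mono_poly ps @ [G])"
proof -
  define Q where "Q ps \<longleftrightarrow> distinct ps \<and> set ps \<subseteq> M \<and>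
    (\<forall>s\<le>length ps. \<not> F dvd ham.wronskian F (map mono_poly (take s ps)))" for ps
  have len: "length ps \<le> card M" if "Q ps" for ps
    using that card_mono[OF M, of "set ps"] by (simp add: Q_def distinct_card)
  have "Q []" using F by (simp add: Q_def)
  then have "\<exists>ps. Q ps \<and> (\<forall>ps'. Q ps' \<longrightarrow> length ps' \<le> length ps)"
    by (rule ex_has_greatest_nat[where b = "Suc (card M)"]) (use len in \<open>simp add: less_Suc_eq_le\<close>)
  then obtain ps where ps: "Q ps" "\<And>ps'. Q ps' \<Longrightarrow> length ps' \<le> length ps"
    by blast
  have "F dvd ham.wronskian F (map mono_poly ps @ [mono_poly p])" if p: "p \<in> M" for p
  proof (cases "p \<in> set ps")
    case True
    then show ?thesis by (simp add: ham.wronskian_append_eq_0)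
  next
    case False
    \<comment> \<open>The prefixes inherited from \<open>ps\<close> satisfy the condition, so the
      failure must occur at the full extended list.\<close>
    then have "\<not> Q (ps @ [p])" using ps(2)[of "ps @ [p]"] by auto
    then obtain s where s: "s \<le> Suc (length ps)" "F dvd ham.wronskian F (map mono_poly (take s (ps @ [p])))"
      using ps(1) False p by (auto simp: Q_def)
    with ps(1) have "s = Suc (length ps)"
      by (cases "s \<le> length ps") (auto simp: Q_def)
    with s show ?thesis by simp
  qed
  then have "F dvd ham.wronskian F (map mono_poly ps @ [G])"
    by (rule wronskian_append_dvd[OF G])
  then show ?thesis using that len[OF ps(1)] ps(1) by (auto simp: Q_def)
qed

section \<open>Branches of a plane curve\<close>

definition roots_over :: "real poly poly \<Rightarrow> real \<Rightarrow> real set" where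
  "roots_over F x = {y. bipoly_eval F x y = 0}"

text \<open>Over such an abscissa no root escapes to infinity and all real roots are simple, so near
  it the real roots move continuously and keep their number.\<close>

definition regular_over :: "real poly poly \<Rightarrow> real \<Rightarrow> bool" where
  "regular_over F x \<longleftrightarrow> poly (lead_coeff F) x \<noteq> 0 \<and>
     (\<forall>y. bipoly_eval F x y = 0 \<longrightarrow> bipoly_eval (dY F) x y \<noteq> 0)"

lemma bipoly_eval_eq_poly_map_poly: "bipoly_eval F x y = poly (map_poly (\<lambda>c. poly c x) F) (y :: real)"
  by (induction F) (auto simp: map_poly_pCons)

lemma bipoly_eval_eq_sum_coeff:
  "bipoly_eval F x y = (\<Sum>i\<le>degree F. poly (coeff F i) x * (y :: real) ^ i)"
  unfolding bipoly_eval_def poly_altdef[of F] by (simp add: poly_sum poly_power)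

lemma roots_over_finite:
  assumes "map_poly (\<lambda>c. poly c x) F \<noteq> 0"
  shows "finite (roots_over F x)" "card (roots_over F x) \<le> degree F"
proof -
  have *: "roots_over F x = {y. poly (map_poly (\<lambda>c. poly c x) F) y = 0}"
    by (simp add: roots_over_def bipoly_eval_eq_poly_map_poly)
  show "finite (roots_over F x)"
    unfolding * by (rule poly_roots_finite[OF assms])
  have "card (roots_over F x) \<le> degree (map_poly (\<lambda>c. poly c x) F)"
    unfolding * by (rule card_poly_roots_bound[OF assms])
  also have "\<dots> \<le> degree F" by (rule degree_le) (auto simp: coeff_map_poly coeff_eq_0)
  finally show "card (roots_over F x) \<le> degree F" .
qed

lemma regular_over_map_poly: "regular_over F x \<Longrightarrow> map_poly (\<lambda>c. poly c x) F \<noteq> 0"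
proof
  assume "regular_over F x" "map_poly (\<lambda>c. poly c x) F = 0"
  moreover have "coeff (map_poly (\<lambda>c. poly c x) F) (degree F) = poly (lead_coeff F) x"
    by (simp add: coeff_map_poly)
  ultimately show False by (simp add: regular_over_def)
qed

text \<open>A first-order Taylor formula with polynomial quotients \<open>A\<close> and
  \<open>B\<close>; these are therefore continuous along any continuous branch.\<close>

lemma bipoly_first_order_expansion:
  "\<exists>A B. (\<forall>x y. bipoly_eval F x y = bipoly_eval F x0 y0 + bipoly_eval A x y * (x - x0) +
      bipoly_eval B x y * (y - y0)) \<and>
    bipoly_eval A x0 y0 = bipoly_eval (dX F) x0 y0 \<and> bipoly_eval B x0 y0 = bipoly_eval (dY F) x0 (y0 :: real)"
proof (induction F)
  case 0
  show ?case by (intro exI[of _ 0]) simp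
next
  case (pCons c F)
  then obtain A B where AB:
    "\<And>x y. bipoly_eval F x y = bipoly_eval F x0 y0 + bipoly_eval A x y * (x - x0) + bipoly_eval B x y * (y - y0)"
    "bipoly_eval A x0 y0 = bipoly_eval (dX F) x0 y0" "bipoly_eval B x0 y0 = bipoly_eval (dY F) x0 y0"
    by blast
  define c1 where "c1 = synthetic_div c x0"
  have c: "c = [:poly c x0:] + [:- x0, 1:] * c1"
    using synthetic_div_correct'[of x0 c] by (simp add: c1_def add.commute)
  have "pderiv c = pderiv ([:poly c x0:] + [:- x0, 1:] * c1)"
    using c by simp
  then have c1: "poly (pderiv c) x0 = poly c1 x0"
    by (simp only: pderiv_add pderiv_mult) (simp add: pderiv_pCons)
  have c2: "poly c x = poly c x0 + poly c1 x * (x - x0)" for x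
    by (subst c) (simp add: algebra_simps)
  \<comment> \<open>With this value, y F(x, y) - y0 k = y (F(x, y) - k) + k (y - y0), which dictates
    the new quotients.\<close>
  define k where "k = bipoly_eval F x0 y0"
  show ?case
  proof (intro exI conjI allI)
    fix x y
    show "bipoly_eval (pCons c F) x y = bipoly_eval (pCons c F) x0 y0 +
      bipoly_eval (pCons c1 A) x y * (x - x0) + bipoly_eval (pCons [:k:] B) x y * (y - y0)"
      by (simp only: bipoly_eval_simps AB(1)[of x y] c2[of x] k_def poly_pCons poly_0) (simp add: algebra_simps)
    show "bipoly_eval (pCons c1 A) x0 y0 = bipoly_eval (dX (pCons c F)) x0 y0"
      by (simp add: AB(2) c1)
    show "bipoly_eval (pCons [:k:] B) x0 y0 = bipoly_eval (dY (pCons c F)) x0 y0"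
      by (simp add: AB(3) pderiv_pCons k_def)
  qed
qed

text \<open>On the curve the expansion reads A (x - x0) + B (y - y0) = 0 exactly, so the difference
  quotient is -A / B. Continuity of the branch thus already yields its differentiability.\<close>

lemma implicit_derivative:
  assumes cont: "isCont \<psi> x0" and nz: "bipoly_eval (dY F) x0 (\<psi> x0) \<noteq> 0"
    and zero: "\<forall>\<^sub>F x in nhds x0. bipoly_eval F x (\<psi> x) = 0"
  shows "(\<psi> has_real_derivative - bipoly_eval (dX F) x0 (\<psi> x0) / bipoly_eval (dY F) x0 (\<psi> x0)) (at x0)"
proof -
  obtain A B where AB:
    "\<And>x y. bipoly_eval F x y = bipoly_eval F x0 (\<psi> x0) + bipoly_eval A x y * (x - x0) + bipoly_eval B x y * (y - \<psi> x0)"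
    "bipoly_eval A x0 (\<psi> x0) = bipoly_eval (dX F) x0 (\<psi> x0)"
    "bipoly_eval B x0 (\<psi> x0) = bipoly_eval (dY F) x0 (\<psi> x0)"
    using bipoly_first_order_expansion[of F x0 "\<psi> x0"] by blast
  have F0: "bipoly_eval F x0 (\<psi> x0) = 0"
    using zero by (simp add: eventually_nhds_conv_at)
  have lim: "((\<lambda>x. bipoly_eval P x (\<psi> x)) \<longlongrightarrow> bipoly_eval P x0 (\<psi> x0)) (at x0)" for P
  proof (induction P)
    case (pCons c P)
    have "(\<psi> \<longlongrightarrow> \<psi> x0) (at x0)" using cont by (simp add: isCont_def)
    with pCons(2) show ?case by (auto intro!: tendsto_intros)
  qed simp
  have "((\<lambda>x. - bipoly_eval A x (\<psi> x) / bipoly_eval B x (\<psi> x)) \<longlongrightarrow>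
      - bipoly_eval A x0 (\<psi> x0) / bipoly_eval B x0 (\<psi> x0)) (at x0)"
    using nz AB(3) by (intro tendsto_intros lim) auto
  moreover have "\<forall>\<^sub>F x in at x0. - bipoly_eval A x (\<psi> x) / bipoly_eval B x (\<psi> x) = (\<psi> x - \<psi> x0) / (x - x0)"
  proof -
    have "\<forall>\<^sub>F x in at x0. bipoly_eval B x (\<psi> x) \<noteq> 0"
      using nz AB(3) by (intro tendsto_imp_eventually_ne[OF lim]) auto
    moreover have "\<forall>\<^sub>F x in at x0. bipoly_eval F x (\<psi> x) = 0"
      using zero by (simp add: eventually_nhds_conv_at)
    moreover have "\<forall>\<^sub>F x in at x0. x \<noteq> x0" by (simp add: eventually_at_filter)
    ultimately show ?thesis
    proof eventually_elim
      case (elim x)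
      then have "bipoly_eval A x (\<psi> x) * (x - x0) + bipoly_eval B x (\<psi> x) * (\<psi> x - \<psi> x0) = 0"
        using AB(1)[of x "\<psi> x"] F0 by simp
      with elim show ?case by (simp add: field_simps)
    qed
  qed
  ultimately have "((\<lambda>x. (\<psi> x - \<psi> x0) / (x - x0)) \<longlongrightarrow>
      - bipoly_eval A x0 (\<psi> x0) / bipoly_eval B x0 (\<psi> x0)) (at x0)"
    by (rule Lim_transform_eventually)
  then show ?thesis by (simp add: has_field_derivative_iff AB)
qed

section \<open>Continuity of simple roots\<close>

lemma sign_change_at_simple_root:
  fixes f :: "real \<Rightarrow> real"
  assumes f: "(f has_real_derivative l) (at y)" and l: "l \<noteq> 0" and "f y = 0"
  shows "\<exists>d>0. \<forall>h. 0 < h \<and> h < d \<longrightarrow> f (y - h) * f (y + h) < 0"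
proof (cases "l > 0")
  case True
  obtain d1 where "d1 > 0" "\<And>h. 0 < h \<Longrightarrow> h < d1 \<Longrightarrow> f (y - h) < f y"
    using DERIV_pos_inc_left[OF f True] by auto
  moreover obtain d2 where "d2 > 0" "\<And>h. 0 < h \<Longrightarrow> h < d2 \<Longrightarrow> f y < f (y + h)"
    using DERIV_pos_inc_right[OF f True] by auto
  ultimately show ?thesis
    using \<open>f y = 0\<close> by (intro exI[of _ "min d1 d2"]) (auto simp: mult_less_0_iff)
next
  case False
  with l have "l < 0" by simp
  obtain d1 where "d1 > 0" "\<And>h. 0 < h \<Longrightarrow> h < d1 \<Longrightarrow> f (y - h) > f y"
    using DERIV_neg_dec_left[OF f \<open>l < 0\<close>] by auto
  moreover obtain d2 where "d2 > 0" "\<And>h. 0 < h \<Longrightarrow> h < d2 \<Longrightarrow> f y > f (y + h)"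
    using DERIV_neg_dec_right[OF f \<open>l < 0\<close>] by auto
  ultimately show ?thesis
    using \<open>f y = 0\<close> by (intro exI[of _ "min d1 d2"]) (auto simp: mult_less_0_iff)
qed

lemma ex_root_of_sign_change:
  fixes f :: "real \<Rightarrow> real"
  assumes "a \<le> b" "continuous_on {a..b} f" "f a * f b < 0"
  shows "\<exists>w. a < w \<and> w < b \<and> f w = 0"
proof -
  have "\<exists>w\<ge>a. w \<le> b \<and> f w = 0"
  proof (cases "f a < 0")
    case True
    with assms show ?thesis using IVT'[of f a 0 b] by (auto simp: mult_less_0_iff)
  next
    case False
    with assms show ?thesis using IVT2'[of f b 0 a] by (auto simp: mult_less_0_iff)
  qed
  then obtain w where "a \<le> w" "w \<le> b" "f w = 0" by auto
  moreover from this assms(3) have "w \<noteq> a" "w \<noteq> b" by auto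
  ultimately show ?thesis by (intro exI[of _ w]) auto
qed

lemma has_derivative_second:
  "(bipoly_eval F x has_real_derivative bipoly_eval (dY F) x y) (at y)"
  using bipoly_eval_has_derivative[of "\<lambda>_. x" 0 y "\<lambda>y. y" 1 F] by simp

lemma continuous_on_second: "continuous_on S (bipoly_eval F (x :: real))"
  by (meson continuous_at_imp_continuous_on DERIV_isCont has_derivative_second)

lemma isCont_first: "isCont (\<lambda>x. bipoly_eval F x y) (x :: real)"
  using continuous_bipoly_eval[of UNIV "\<lambda>x. x" "\<lambda>_. y" F]
  by (simp add: continuous_on_eq_continuous_at)

text \<open>The sign change at a simple root persists under a small change of \<open>x\<close>, and
  the intermediate value theorem finds the root.\<close>

lemma eventually_ex_root_near:
  fixes F :: "real poly poly"
  assumes "bipoly_eval F x0 y = 0" "bipoly_eval (dY F) x0 y \<noteq> 0" "\<epsilon> > 0"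
  shows "\<forall>\<^sub>F x in nhds x0. \<exists>w. \<bar>w - y\<bar> < \<epsilon> \<and> bipoly_eval F x w = 0"
proof -
  obtain d where d: "d > 0" "\<And>h. 0 < h \<Longrightarrow> h < d \<Longrightarrow> bipoly_eval F x0 (y - h) * bipoly_eval F x0 (y + h) < 0"
    using sign_change_at_simple_root[OF has_derivative_second[of F x0 y] assms(2,1)] by blast
  define h where "h = min d \<epsilon> / 2"
  have h: "0 < h" "h < d" "h < \<epsilon>" using d(1) assms(3) by (auto simp: h_def)
  have "isCont (\<lambda>x. bipoly_eval F x (y - h) * bipoly_eval F x (y + h)) x0"
    by (intro isCont_mult isCont_first)
  then have "((\<lambda>x. bipoly_eval F x (y - h) * bipoly_eval F x (y + h)) \<longlongrightarrow>
      bipoly_eval F x0 (y - h) * bipoly_eval F x0 (y + h)) (nhds x0)"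
    by (simp add: continuous_at_imp_continuous_at_within isCont_def tendsto_nhds_iff)
  then have "\<forall>\<^sub>F x in nhds x0. bipoly_eval F x (y - h) * bipoly_eval F x (y + h) < 0"
    by (rule order_tendstoD(2)) (rule d(2)[OF h(1,2)])
  then show ?thesis
  proof eventually_elim
    case (elim x)
    obtain w where "y - h < w" "w < y + h" "bipoly_eval F x w = 0"
      using ex_root_of_sign_change[of "y - h" "y + h" "bipoly_eval F x", OF _ continuous_on_second elim] h(1)
      by auto
    with h(3) show ?case by (intro exI[of _ w]) auto
  qed
qed

text \<open>Cauchy's root bound \<open>h\<close> is continuous in \<open>x\<close> wherever the
  leading coefficient does not vanish.\<close>

lemma eventually_roots_bounded:
  assumes "poly (lead_coeff F) x0 \<noteq> 0"
  shows "\<exists>M. \<forall>\<^sub>F x in nhds x0. \<forall>y\<in>roots_over F x. \<bar>y\<bar> \<le> M"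
proof -
  define n where "n = degree F"
  define h where "h x = 1 + (\<Sum>i<n. \<bar>poly (coeff F i) x\<bar>) / \<bar>poly (lead_coeff F) x\<bar>" for x
  have bound: "\<bar>y\<bar> \<le> h x" if lc: "poly (lead_coeff F) x \<noteq> 0" and y: "y \<in> roots_over F x" for x y
  proof (cases "\<bar>y\<bar> \<le> 1")
    case True
    then show ?thesis unfolding h_def
      by (intro add_increasing2 divide_nonneg_nonneg sum_nonneg) auto
  next
    case False
    have "0 = (\<Sum>i<Suc n. poly (coeff F i) x * y ^ i)"
      using y by (simp add: roots_over_def bipoly_eval_eq_sum_coeff n_def lessThan_Suc_atMost del: sum.lessThan_Suc)
    then have eq: "poly (lead_coeff F) x * y ^ n = - (\<Sum>i<n. poly (coeff F i) x * y ^ i)"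
      by (simp add: n_def)
    have "n \<noteq> 0"
      using eq lc by (intro notI) simp
    have "\<bar>poly (lead_coeff F) x\<bar> * \<bar>y\<bar> ^ n \<le> (\<Sum>i<n. \<bar>poly (coeff F i) x * y ^ i\<bar>)"
      using arg_cong[OF eq, of abs] sum_abs[of "\<lambda>i. poly (coeff F i) x * y ^ i" "{..<n}"]
      by (simp add: abs_mult power_abs)
    also have "\<dots> \<le> (\<Sum>i<n. \<bar>poly (coeff F i) x\<bar> * \<bar>y\<bar> ^ (n - 1))"
      using False by (intro sum_mono) (auto simp: abs_mult power_abs intro!: mult_left_mono power_increasing)
    also have "\<dots> = (\<Sum>i<n. \<bar>poly (coeff F i) x\<bar>) * \<bar>y\<bar> ^ (n - 1)"
      by (simp add: sum_distrib_right)
    finally have "(\<bar>poly (lead_coeff F) x\<bar> * \<bar>y\<bar>) * \<bar>y\<bar> ^ (n - 1) \<le>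
        (\<Sum>i<n. \<bar>poly (coeff F i) x\<bar>) * \<bar>y\<bar> ^ (n - 1)"
      using \<open>n \<noteq> 0\<close> by (cases n) (auto simp: algebra_simps)
    then have "\<bar>poly (lead_coeff F) x\<bar> * \<bar>y\<bar> \<le> (\<Sum>i<n. \<bar>poly (coeff F i) x\<bar>)"
      by (rule mult_right_le_imp_le) (use False in \<open>intro zero_less_power, simp\<close>)
    then show ?thesis
      using lc by (simp add: h_def field_simps)
  qed
  have lc_cont: "isCont (\<lambda>x. poly (lead_coeff F) x) x0" by simp
  have "isCont h x0"
    unfolding h_def using assms by (intro continuous_intros) auto
  then have "\<forall>\<^sub>F x in nhds x0. h x < h x0 + 1"
    by (intro order_tendstoD(2)) (auto simp: isCont_def tendsto_nhds_iff)
  moreover have "\<forall>\<^sub>F x in nhds x0. poly (lead_coeff F) x \<noteq> 0"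
    using assms lc_cont by (intro tendsto_imp_eventually_ne[of _ "poly (lead_coeff F) x0"])
      (auto simp: isCont_def tendsto_nhds_iff)
  ultimately have "\<forall>\<^sub>F x in nhds x0. \<forall>y\<in>roots_over F x. \<bar>y\<bar> \<le> h x0 + 1"
    by eventually_elim (use bound in force)
  then show ?thesis by blast
qed

text \<open>By compactness: the points of the curve in a bounded box that stay at distance at least
  \<open>\<epsilon>\<close> from all roots over \<open>x0\<close> form a compact set. Its projection
  is closed and misses \<open>x0\<close>.\<close>

lemma eventually_roots_near:
  assumes "poly (lead_coeff F) x0 \<noteq> 0" and "\<epsilon> > 0"
  shows "\<forall>\<^sub>F x in nhds x0. \<forall>w\<in>roots_over F x. \<exists>y\<in>roots_over F x0. \<bar>w - y\<bar> < \<epsilon>"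
proof -
  obtain M \<delta> where \<delta>: "\<delta> > 0" "\<And>x y. dist x x0 < \<delta> \<Longrightarrow> y \<in> roots_over F x \<Longrightarrow> \<bar>y\<bar> \<le> M"
    using eventually_roots_bounded[OF assms(1)] by (auto simp: eventually_nhds_metric)
  define K where "K = (cball x0 (\<delta> / 2) \<times> {-M..M}) \<inter> {p. bipoly_eval F (fst p) (snd p) = 0} \<inter>
    (\<Inter>y\<in>roots_over F x0. {p. \<epsilon> \<le> \<bar>snd p - y\<bar>})"
  have "closed {p :: real \<times> real. bipoly_eval F (fst p) (snd p) = 0}"
    by (intro closed_Collect_eq continuous_intros)
  moreover have "closed (\<Inter>y\<in>roots_over F x0. {p :: real \<times> real. \<epsilon> \<le> \<bar>snd p - y\<bar>})"
    by (intro closed_INT ballI closed_Collect_le continuous_intros)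
  ultimately have "compact K"
    unfolding K_def by (intro compact_Int_closed compact_Times) auto
  then have "closed (fst ` K)"
    by (intro compact_imp_closed compact_continuous_image continuous_intros)
  moreover have "x0 \<notin> fst ` K"
    using assms(2) by (fastforce simp: K_def roots_over_def)
  ultimately have "\<forall>\<^sub>F x in nhds x0. x \<in> - fst ` K"
    by (intro eventually_nhds_in_open) auto
  moreover have "\<forall>\<^sub>F x in nhds x0. dist x x0 < \<delta> / 2"
    using \<delta>(1) by (auto simp: eventually_nhds_metric intro!: exI[of _ "\<delta> / 2"])
  ultimately show ?thesis
  proof eventually_elim
    case (elim x)
    show ?case
    proof (rule ballI, rule ccontr)
      fix w assume w: "w \<in> roots_over F x" "\<not> (\<exists>y\<in>roots_over F x0. \<bar>w - y\<bar> < \<epsilon>)"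
      then have "\<bar>w\<bar> \<le> M" using \<delta> elim(2) by (intro \<delta>(2)[of x]) auto
      with w elim(2) have "(x, w) \<in> K"
        by (auto simp: K_def roots_over_def dist_commute not_less)
      with elim(1) show False by force
    qed
  qed
qed

text \<open>The Y-derivative is nonzero on a whole box around the point, and by Rolle two roots on
  one vertical segment of it would give a zero of that derivative.\<close>

lemma eventually_unique_root_near:
  fixes F :: "real poly poly"
  assumes "bipoly_eval (dY F) x0 y \<noteq> 0"
  shows "\<exists>r>0. \<forall>\<^sub>F x in nhds x0. \<forall>w w'. \<bar>w - y\<bar> < r \<longrightarrow> \<bar>w' - y\<bar> < r \<longrightarrow>
    bipoly_eval F x w = 0 \<longrightarrow> bipoly_eval F x w' = 0 \<longrightarrow> w = w'"
proof -
  have "open {p :: real \<times> real. bipoly_eval (dY F) (fst p) (snd p) \<noteq> 0}"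
    by (intro open_Collect_neq continuous_intros)
  moreover have "(x0, y) \<in> {p. bipoly_eval (dY F) (fst p) (snd p) \<noteq> 0}"
    using assms by simp
  ultimately obtain A B where AB': "open A" "open B" "(x0, y) \<in> A \<times> B"
      "A \<times> B \<subseteq> {p. bipoly_eval (dY F) (fst p) (snd p) \<noteq> 0}"
    by (rule open_prod_elim)
  then have AB: "open A" "open B" "x0 \<in> A" "y \<in> B"
      "A \<times> B \<subseteq> {p. bipoly_eval (dY F) (fst p) (snd p) \<noteq> 0}"
    by auto
  obtain r where r: "r > 0" "ball y r \<subseteq> B"
    using AB(2,4) open_contains_ball by blast
  have uniq: "\<not> w < w'"
    if "x \<in> A" "\<bar>w - y\<bar> < r" "\<bar>w' - y\<bar> < r" "bipoly_eval F x w = 0" "bipoly_eval F x w' = 0" for x w w'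
  proof
    assume "w < w'"
    moreover have "bipoly_eval F x w = bipoly_eval F x w'" using that by simp
    ultimately obtain z where z: "w < z" "z < w'" "(\<lambda>h. bipoly_eval (dY F) x z * h) = (\<lambda>h. 0)"
      using Rolle_deriv[of w w' "bipoly_eval F x" "\<lambda>z h. bipoly_eval (dY F) x z * h"]
        continuous_on_second[of "{w..w'}" F x] has_derivative_second[of F x]
      unfolding has_field_derivative_def by blast
    from fun_cong[OF z(3), of 1] have z0: "bipoly_eval (dY F) x z = 0" by simp
    from z have "z \<in> ball y r" using that by (auto simp: dist_real_def)
    with r(2) that(1) have "(x, z) \<in> A \<times> B" by blast
    with AB(5) have "(x, z) \<in> {p. bipoly_eval (dY F) (fst p) (snd p) \<noteq> 0}" by blast
    with z0 show False by simp
  qed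
  have "\<forall>\<^sub>F x in nhds x0. x \<in> A"
    by (rule eventually_nhds_in_open[OF AB(1,3)])
  then have "\<forall>\<^sub>F x in nhds x0. \<forall>w w'. \<bar>w - y\<bar> < r \<longrightarrow> \<bar>w' - y\<bar> < r \<longrightarrow>
    bipoly_eval F x w = 0 \<longrightarrow> bipoly_eval F x w' = 0 \<longrightarrow> w = w'"
  proof eventually_elim
    case (elim x)
    show ?case
    proof (intro allI impI)
      fix w w' assume "\<bar>w - y\<bar> < r" "\<bar>w' - y\<bar> < r" "bipoly_eval F x w = 0" "bipoly_eval F x w' = 0"
      with uniq[OF elim, of w w'] uniq[OF elim, of w' w] show "w = w'" by linarith
    qed
  qed
  with r(1) show ?thesis by blast
qed

text \<open>Combines existence and uniqueness of a root near each simple root with the absence of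
  other roots over nearby abscissae.\<close>

lemma local_branches:
  assumes reg: "regular_over F x0"
  obtains \<psi> where "\<And>y. y \<in> roots_over F x0 \<Longrightarrow> \<psi> y x0 = y"
    "\<And>y. y \<in> roots_over F x0 \<Longrightarrow> isCont (\<psi> y) x0"
    "\<forall>\<^sub>F x in nhds x0. bij_betw (\<lambda>y. \<psi> y x) (roots_over F x0) (roots_over F x)"
    "\<forall>\<^sub>F x in nhds x0. \<forall>y\<in>roots_over F x0. \<forall>y'\<in>roots_over F x0. y < y' \<longrightarrow> \<psi> y x < \<psi> y' x"
proof -
  let ?R = "roots_over F x0"
  have fin: "finite ?R"
    by (rule roots_over_finite[OF regular_over_map_poly[OF reg]])
  have simple: "bipoly_eval F x0 y = 0" "bipoly_eval (dY F) x0 y \<noteq> 0" if "y \<in> ?R" for y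
    using reg that by (auto simp: regular_over_def roots_over_def)
  have "\<forall>y\<in>?R. \<exists>r>0. \<forall>\<^sub>F x in nhds x0. \<forall>w w'. \<bar>w - y\<bar> < r \<longrightarrow> \<bar>w' - y\<bar> < r \<longrightarrow>
      bipoly_eval F x w = 0 \<longrightarrow> bipoly_eval F x w' = 0 \<longrightarrow> w = w'"
    using simple(2) by (intro ballI eventually_unique_root_near)
  from bchoice[OF this] obtain r where r: "\<And>y. y \<in> ?R \<Longrightarrow> r y > 0"
    "\<And>y. y \<in> ?R \<Longrightarrow> \<forall>\<^sub>F x in nhds x0. \<forall>w w'. \<bar>w - y\<bar> < r y \<longrightarrow> \<bar>w' - y\<bar> < r y \<longrightarrow>
      bipoly_eval F x w = 0 \<longrightarrow> bipoly_eval F x w' = 0 \<longrightarrow> w = w'"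
    by blast
  \<comment> \<open>The entry 1 keeps the set nonempty when there are few roots or none; the half
    distances keep the neighbourhoods of distinct roots disjoint, hence in their original
    order.\<close>
  define \<epsilon> where "\<epsilon> = Min (insert 1 (r ` ?R \<union> (\<lambda>(y, y'). \<bar>y - y'\<bar> / 2) ` {(y, y') \<in> ?R \<times> ?R. y \<noteq> y'}))"
  have fin2: "finite {(y, y') \<in> ?R \<times> ?R. y \<noteq> y'}"
    by (rule finite_subset[of _ "?R \<times> ?R"]) (use fin in auto)
  have \<epsilon>: "\<epsilon> > 0" unfolding \<epsilon>_def
    using fin fin2 r(1) by (subst Min_gr_iff) auto
  have \<epsilon>r: "\<epsilon> \<le> r y" if "y \<in> ?R" for y
    unfolding \<epsilon>_def using fin fin2 that by (intro Min_le) auto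
  have \<epsilon>sep: "\<epsilon> \<le> \<bar>y - y'\<bar> / 2" if "y \<in> ?R" "y' \<in> ?R" "y \<noteq> y'" for y y'
    unfolding \<epsilon>_def using fin fin2 that by (intro Min_le) auto
  define \<psi> where "\<psi> y x = (THE w. \<bar>w - y\<bar> < \<epsilon> \<and> bipoly_eval F x w = 0)" for y x
  have "\<forall>\<^sub>F x in nhds x0. \<forall>y\<in>?R. \<forall>w w'. \<bar>w - y\<bar> < r y \<longrightarrow> \<bar>w' - y\<bar> < r y \<longrightarrow>
      bipoly_eval F x w = 0 \<longrightarrow> bipoly_eval F x w' = 0 \<longrightarrow> w = w'"
    using fin r(2) by (simp add: eventually_ball_finite)
  then have uniq: "\<forall>\<^sub>F x in nhds x0. \<forall>y\<in>?R. \<forall>w. \<bar>w - y\<bar> < \<epsilon> \<longrightarrow> bipoly_eval F x w = 0 \<longrightarrow> \<psi> y x = w"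
  proof eventually_elim
    case (elim x)
    show ?case
    proof (intro ballI allI impI)
      fix y w assume y: "y \<in> ?R" and w: "\<bar>w - y\<bar> < \<epsilon>" "bipoly_eval F x w = 0"
      have "w' = w" if "\<bar>w' - y\<bar> < \<epsilon>" "bipoly_eval F x w' = 0" for w'
      proof -
        have "\<bar>w' - y\<bar> < r y" "\<bar>w - y\<bar> < r y" using that(1) w(1) \<epsilon>r[OF y] by linarith+
        with elim y that(2) w(2) show ?thesis by blast
      qed
      then show "\<psi> y x = w" unfolding \<psi>_def by (intro the_equality conjI w) blast
    qed
  qed
  have near: "\<forall>\<^sub>F x in nhds x0. \<forall>y\<in>?R. \<bar>\<psi> y x - y\<bar> < \<epsilon>' \<and> bipoly_eval F x (\<psi> y x) = 0"
    if "\<epsilon>' > 0" "\<epsilon>' \<le> \<epsilon>" for \<epsilon>'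
  proof -
    have "\<forall>\<^sub>F x in nhds x0. \<forall>y\<in>?R. \<exists>w. \<bar>w - y\<bar> < \<epsilon>' \<and> bipoly_eval F x w = 0"
      using fin simple that(1) by (intro eventually_ball_finite ballI eventually_ex_root_near) auto
    with uniq show ?thesis
    proof eventually_elim
      case (elim x)
      show ?case
      proof
        fix y assume y: "y \<in> ?R"
        then obtain w where w: "\<bar>w - y\<bar> < \<epsilon>'" "bipoly_eval F x w = 0" using elim(2) by blast
        with elim(1) y that(2) have "\<psi> y x = w" by (meson less_le_trans)
        with w show "\<bar>\<psi> y x - y\<bar> < \<epsilon>' \<and> bipoly_eval F x (\<psi> y x) = 0" by simp
      qed
    qed
  qed
  show ?thesis
  proof (rule that)
    fix y assume y: "y \<in> ?R"
    show "\<psi> y x0 = y"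
      using eventually_nhds_x_imp_x[OF uniq] y simple(1)[OF y] \<epsilon> by auto
    then show "isCont (\<psi> y) x0"
      unfolding isCont_def tendsto_iff
    proof safe
      fix e :: real assume "e > 0"
      have "\<forall>\<^sub>F x in nhds x0. \<bar>\<psi> y x - y\<bar> < min e \<epsilon>"
        using near[of "min e \<epsilon>"] \<open>e > 0\<close> \<epsilon> y by (auto elim!: eventually_mono)
      then show "\<forall>\<^sub>F x in at x0. dist (\<psi> y x) (\<psi> y x0) < e"
        unfolding \<open>\<psi> y x0 = y\<close> by (auto simp: dist_real_def eventually_at_filter elim!: eventually_mono)
    qed
  next
    have order: "\<psi> y x < \<psi> y' x"
      if "\<forall>y\<in>?R. \<bar>\<psi> y x - y\<bar> < \<epsilon> \<and> bipoly_eval F x (\<psi> y x) = 0" "y \<in> ?R" "y' \<in> ?R" "y < y'" for x y y'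
    proof -
      have "\<bar>\<psi> y x - y\<bar> < \<epsilon>" "\<bar>\<psi> y' x - y'\<bar> < \<epsilon>" using that(1-3) by blast+
      with \<epsilon>sep[of y y'] that(2-4) show ?thesis by (auto simp: abs_if split: if_splits)
    qed
    show "\<forall>\<^sub>F x in nhds x0. \<forall>y\<in>?R. \<forall>y'\<in>?R. y < y' \<longrightarrow> \<psi> y x < \<psi> y' x"
      using near[OF \<epsilon> order.refl] by eventually_elim (use order in blast)
    from near[OF \<epsilon> order.refl] eventually_roots_near[of F x0, OF _ \<epsilon>] uniq
    have "\<forall>\<^sub>F x in nhds x0. (\<forall>y\<in>?R. \<bar>\<psi> y x - y\<bar> < \<epsilon> \<and> bipoly_eval F x (\<psi> y x) = 0) \<and>
        (\<forall>w\<in>roots_over F x. \<exists>y\<in>?R. \<bar>w - y\<bar> < \<epsilon>) \<and>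
        (\<forall>y\<in>?R. \<forall>w. \<bar>w - y\<bar> < \<epsilon> \<longrightarrow> bipoly_eval F x w = 0 \<longrightarrow> \<psi> y x = w)"
      using reg by (auto simp: regular_over_def eventually_conj_iff)
    then show "\<forall>\<^sub>F x in nhds x0. bij_betw (\<lambda>y. \<psi> y x) ?R (roots_over F x)"
    proof eventually_elim
      case (elim x)
      have "inj_on (\<lambda>y. \<psi> y x) ?R"
      proof (rule linorder_inj_onI)
        fix y y' assume "y < y'" "y \<in> ?R" "y' \<in> ?R"
        then show "\<psi> y x \<noteq> \<psi> y' x"
          using order[OF conjunct1[OF elim], of y y'] by simp
      qed (rule linear)
      moreover have "(\<lambda>y. \<psi> y x) ` ?R \<subseteq> roots_over F x"
        using elim by (auto simp: roots_over_def)
      moreover have "w \<in> (\<lambda>y. \<psi> y x) ` ?R" if w: "w \<in> roots_over F x" for w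
      proof -
        obtain y where "y \<in> ?R" "\<bar>w - y\<bar> < \<epsilon>"
          using conjunct1[OF conjunct2[OF elim]] w by blast
        moreover have "bipoly_eval F x w = 0" using that by (simp add: roots_over_def)
        ultimately have "\<psi> y x = w"
          using conjunct2[OF conjunct2[OF elim], rule_format, of y w] by simp
        with \<open>y \<in> ?R\<close> show ?thesis by blast
      qed
      ultimately show ?case unfolding bij_betw_def by blast
    qed
  qed
qed

section \<open>Numbering the roots by rank\<close>

lemma bij_betw_rank:
  fixes S :: "'a::linorder set"
  assumes "finite S"
  shows "bij_betw (\<lambda>y. card {w\<in>S. w < y}) S {..<card S}"
proof -
  have less: "card {w\<in>S. w < y} < card {w\<in>S. w < y'}" if "y \<in> S" "y' \<in> S" "y < y'" for y y'
    using assms that by (intro psubset_card_mono) auto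
  have "inj_on (\<lambda>y. card {w\<in>S. w < y}) S"
  proof (rule inj_onI, rule ccontr)
    fix y y' assume "y \<in> S" "y' \<in> S" "card {w\<in>S. w < y} = card {w\<in>S. w < y'}" "y \<noteq> y'"
    with less[of y y'] less[of y' y] show False by (cases y y' rule: linorder_cases) auto
  qed
  moreover have "(\<lambda>y. card {w\<in>S. w < y}) ` S \<subseteq> {..<card S}"
    using assms by (auto intro!: psubset_card_mono)
  ultimately show ?thesis
    using card_subset_eq[of "{..<card S}" "(\<lambda>y. card {w\<in>S. w < y}) ` S"]
    by (simp add: bij_betw_def card_image)
qed

text \<open>The roots are numbered from \<open>0\<close> in increasing order; the value is junk for larger \<open>j\<close>.\<close>
definition branch :: "real poly poly \<Rightarrow> nat \<Rightarrow> real \<Rightarrow> real" where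
  "branch F j x = (THE y. y \<in> roots_over F x \<and> card {w\<in>roots_over F x. w < y} = j)"

lemma branch_eqI:
  assumes "finite (roots_over F x)" "y \<in> roots_over F x" "card {w\<in>roots_over F x. w < y} = j"
  shows "branch F j x = y"
  unfolding branch_def
  using assms bij_betw_rank[OF assms(1)] by (intro the_equality) (auto simp: bij_betw_def inj_on_def)

lemma bij_betw_branch:
  assumes "finite (roots_over F x)"
  shows "bij_betw (\<lambda>j. branch F j x) {..<card (roots_over F x)} (roots_over F x)"
proof -
  let ?rk = "\<lambda>y. card {w\<in>roots_over F x. w < y}"
  note rk = bij_betw_rank[OF assms]
  have "branch F (?rk y) x = y" if "y \<in> roots_over F x" for y
    by (rule branch_eqI[OF assms that refl])
  moreover have "branch F j x \<in> roots_over F x \<and> ?rk (branch F j x) = j" if "j < card (roots_over F x)" for j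
  proof -
    have "j \<in> ?rk ` roots_over F x"
      unfolding bij_betw_imp_surj_on[OF rk] using that by simp
    then obtain y where "y \<in> roots_over F x" "?rk y = j"
      by blast
    with branch_eqI[OF assms this] show ?thesis by simp
  qed
  ultimately show ?thesis
    by (intro bij_betw_byWitness[where f' = ?rk]) (use rk in \<open>auto simp: bij_betw_def\<close>)
qed

text \<open>The local branches preserve the order, so the rank of each is constant near
  \<open>x0\<close>, and \<open>branch F j\<close> agrees there with a single local branch.\<close>

lemma branch_locally:
  assumes reg: "regular_over F x0"
  shows "\<forall>\<^sub>F x in nhds x0. card (roots_over F x) = card (roots_over F x0)"
    and "j < card (roots_over F x0) \<Longrightarrow> isCont (branch F j) x0"
proof -
  let ?R = "roots_over F"
  obtain \<psi> where \<psi>: "\<And>y. y \<in> ?R x0 \<Longrightarrow> \<psi> y x0 = y"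
    "\<And>y. y \<in> ?R x0 \<Longrightarrow> isCont (\<psi> y) x0"
    "\<forall>\<^sub>F x in nhds x0. bij_betw (\<lambda>y. \<psi> y x) (?R x0) (?R x)"
    "\<forall>\<^sub>F x in nhds x0. \<forall>y\<in>?R x0. \<forall>y'\<in>?R x0. y < y' \<longrightarrow> \<psi> y x < \<psi> y' x"
    using local_branches[OF reg] by blast
  show "\<forall>\<^sub>F x in nhds x0. card (?R x) = card (?R x0)"
    using \<psi>(3) by eventually_elim (use bij_betw_same_card in metis)
  assume j: "j < card (?R x0)"
  have fin: "finite (?R x0)"
    by (rule roots_over_finite[OF regular_over_map_poly[OF reg]])
  have "j \<in> (\<lambda>y. card {w\<in>?R x0. w < y}) ` ?R x0"
    unfolding bij_betw_imp_surj_on[OF bij_betw_rank[OF fin]] using j by simp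
  then obtain y where y: "y \<in> ?R x0" "card {w\<in>?R x0. w < y} = j"
    by blast
  have "\<forall>\<^sub>F x in nhds x0. branch F j x = \<psi> y x"
    using \<psi>(3,4)
  proof eventually_elim
    case (elim x)
    have less_iff: "\<psi> w x < \<psi> y x \<longleftrightarrow> w < y" if "w \<in> ?R x0" for w
      using elim(2) that y(1) by (metis less_asym linorder_neqE)
    have "{w\<in>?R x. w < \<psi> y x} = (\<lambda>w. \<psi> w x) ` {w\<in>?R x0. w < y}"
    proof (rule Set.set_eqI)
      fix v
      have "v \<in> ?R x \<longleftrightarrow> (\<exists>w\<in>?R x0. v = \<psi> w x)"
        using elim(1) by (auto simp: bij_betw_def)
      then show "v \<in> {w\<in>?R x. w < \<psi> y x} \<longleftrightarrow> v \<in> (\<lambda>w. \<psi> w x) ` {w\<in>?R x0. w < y}"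
        using less_iff by auto
    qed
    moreover have "inj_on (\<lambda>w. \<psi> w x) {w\<in>?R x0. w < y}"
      using elim(1) by (auto simp: bij_betw_def inj_on_def)
    ultimately have "card {w\<in>?R x. w < \<psi> y x} = j"
      using y(2) by (simp add: card_image)
    moreover have "finite (?R x)" using elim(1) fin bij_betw_finite by metis
    moreover have "\<psi> y x \<in> ?R x" using elim(1) y(1) by (auto simp: bij_betw_def)
    ultimately show ?case by (intro branch_eqI)
  qed
  then show "isCont (branch F j) x0"
    using isCont_cong \<psi>(2)[OF y(1)] by metis
qed

text \<open>The number of roots is locally constant, hence constant on a connected set; the numbered
  branches are then continuous, and differentiable by implicit differentiation.\<close>

theorem branches_over_interval:
  assumes I: "open I" "connected I" and reg: "\<And>x. x \<in> I \<Longrightarrow> regular_over F x"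
  obtains N where "N \<le> degree F"
    "\<And>x. x \<in> I \<Longrightarrow> bij_betw (\<lambda>j. branch F j x) {..<N} (roots_over F x)"
    "\<And>x j. x \<in> I \<Longrightarrow> j < N \<Longrightarrow> (branch F j has_real_derivative
      - bipoly_eval (dX F) x (branch F j x) / bipoly_eval (dY F) x (branch F j x)) (at x)"
proof (cases "I = {}")
  case True
  then show ?thesis using that[of 0] by auto
next
  case False
  then obtain x1 where x1: "x1 \<in> I" by blast
  define N where "N = card (roots_over F x1)"
  have fin: "finite (roots_over F x)" "card (roots_over F x) \<le> degree F" if "x \<in> I" for x
    using roots_over_finite[OF regular_over_map_poly[OF reg[OF that]]] by auto
  have N: "card (roots_over F x) = N" if "x \<in> I" for x
    unfolding N_def
  proof (rule connected_local_const[OF I(2) that x1], rule ballI)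
    fix a assume "a \<in> I"
    with branch_locally(1)[OF reg] have "\<forall>\<^sub>F x in nhds a. card (roots_over F x) = card (roots_over F a)"
      by blast
    then show "\<forall>\<^sub>F b in at a within I. card (roots_over F a) = card (roots_over F b)"
      by (auto simp: eventually_at_filter elim!: eventually_mono)
  qed
  have bij: "bij_betw (\<lambda>j. branch F j x) {..<N} (roots_over F x)" if "x \<in> I" for x
    using bij_betw_branch[OF fin(1)[OF that]] N[OF that] by simp
  show ?thesis
  proof (rule that)
    show "N \<le> degree F" unfolding N_def by (rule fin(2)[OF x1])
    show "bij_betw (\<lambda>j. branch F j x) {..<N} (roots_over F x)" if "x \<in> I" for x by (rule bij[OF that])
    fix x j assume xj: "x \<in> I" "j < N"
    have root: "bipoly_eval F x (branch F j x) = 0" if "x \<in> I" for x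
      using bij[OF that] xj(2) by (auto simp: bij_betw_def roots_over_def)
    show "(branch F j has_real_derivative
      - bipoly_eval (dX F) x (branch F j x) / bipoly_eval (dY F) x (branch F j x)) (at x)"
    proof (rule implicit_derivative)
      show "isCont (branch F j) x"
        using branch_locally(2)[OF reg[OF xj(1)]] xj N by simp
      show "bipoly_eval (dY F) x (branch F j x) \<noteq> 0"
        using reg[OF xj(1)] root[OF xj(1)] by (auto simp: regular_over_def)
      show "\<forall>\<^sub>F x in nhds x. bipoly_eval F x (branch F j x) = 0"
        using eventually_nhds_in_open[OF I(1) xj(1)] by (rule eventually_mono) (rule root)
    qed
  qed
qed

section \<open>Counting zeros along arcs\<close>

text \<open>Counting the separators below a point is strictly increasing on \<open>Z\<close>, with
  values in \<open>{..card U}\<close>.\<close>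

lemma card_le_Suc_card_separators:
  fixes Z U :: "real set"
  assumes U: "finite U" and sep: "\<And>z z'. z \<in> Z \<Longrightarrow> z' \<in> Z \<Longrightarrow> z < z' \<Longrightarrow> \<exists>u\<in>U. z < u \<and> u < z'"
  shows "finite Z \<and> card Z \<le> Suc (card U)"
proof -
  define f where "f z = card {u\<in>U. u < z}" for z
  have less: "f z < f z'" if z: "z \<in> Z" "z' \<in> Z" "z < z'" for z z'
  proof -
    obtain u where "u \<in> U" "z < u" "u < z'" using sep[OF z] by blast
    then have "u \<in> {u\<in>U. u < z'} - {u\<in>U. u < z}" by simp
    moreover have "{u\<in>U. u < z} \<subseteq> {u\<in>U. u < z'}" using z(3) by auto
    ultimately have "{u\<in>U. u < z} \<subset> {u\<in>U. u < z'}" by blast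
    then show ?thesis unfolding f_def using U by (intro psubset_card_mono) auto
  qed
  have "inj_on f Z"
  proof (rule linorder_inj_onI)
    fix z z' assume "z < z'" "z \<in> Z" "z' \<in> Z"
    with less[of z z'] show "f z \<noteq> f z'" by simp
  qed (rule linear)
  moreover have "f ` Z \<subseteq> {..card U}"
    unfolding f_def using U by (auto intro!: card_mono)
  ultimately show ?thesis
    using inj_on_finite[of f Z "{..card U}"] card_inj_on_le[of f Z "{..card U}"] by auto
qed

text \<open>Between two zeros of p that are not zeros of q, either q vanishes or Rolle applies to p
  / q. The factor 2 arises because zeros of q count once as separators and once as possible common
  zeros.\<close>

lemma card_zeros_le_rolle_quotient:
  fixes p q p' q' :: "real \<Rightarrow> real"
  assumes I: "is_interval I"
    and p: "\<And>x. x \<in> I \<Longrightarrow> (p has_real_derivative p' x) (at x)"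
    and q: "\<And>x. x \<in> I \<Longrightarrow> (q has_real_derivative q' x) (at x)"
  defines "Q \<equiv> {x\<in>I. q x = 0}"
  defines "R \<equiv> {x\<in>I. p' x * q x - p x * q' x = 0}"
  assumes fin: "finite Q" "finite R"
  shows "finite {x\<in>I. p x = 0}" "card {x\<in>I. p x = 0} \<le> Suc (2 * card Q + card R)"
proof -
  define Z where "Z = {x\<in>I. p x = 0} - Q"
  have "\<exists>u\<in>Q \<union> R. z < u \<and> u < z'" if z: "z \<in> Z" "z' \<in> Z" "z < z'" for z z'
  proof (rule ccontr)
    assume *: "\<not> (\<exists>u\<in>Q \<union> R. z < u \<and> u < z')"
    have sub: "x \<in> I" if "z \<le> x" "x \<le> z'" for x
      using I z that unfolding is_interval_1 Z_def by blast
    have q0: "q x \<noteq> 0" if "z \<le> x" "x \<le> z'" for x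
    proof
      assume "q x = 0"
      with sub[OF that] have "x \<in> Q" by (simp add: Q_def)
      with z(1,2) have "x \<noteq> z" "x \<noteq> z'" by (auto simp: Z_def)
      with that have "z < x" "x < z'" by auto
      with * \<open>x \<in> Q\<close> show False by blast
    qed
    have der: "((\<lambda>x. p x / q x) has_real_derivative (p' x * q x - p x * q' x) / (q x * q x)) (at x)"
      if "z \<le> x" "x \<le> z'" for x
      by (rule DERIV_divide[OF p[OF sub[OF that]] q[OF sub[OF that]] q0[OF that]])
    have "p z / q z = p z' / q z'" using z by (simp add: Z_def)
    moreover have "continuous_on {z..z'} (\<lambda>x. p x / q x)"
      using der by (auto intro!: continuous_at_imp_continuous_on DERIV_isCont)
    moreover have "((\<lambda>x. p x / q x) has_derivative (\<lambda>h. (p' x * q x - p x * q' x) / (q x * q x) * h)) (at x)"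
      if "z < x" "x < z'" for x
      using der[OF order.strict_implies_order[OF that(1)] order.strict_implies_order[OF that(2)]]
      unfolding has_field_derivative_def .
    ultimately obtain u where u: "z < u" "u < z'"
        "(\<lambda>h. (p' u * q u - p u * q' u) / (q u * q u) * h) = (\<lambda>h. 0)"
      using Rolle_deriv[OF z(3), of "\<lambda>x. p x / q x" "\<lambda>x h. (p' x * q x - p x * q' x) / (q x * q x) * h"]
      by blast
    from fun_cong[OF u(3), of 1] q0[of u] u(1,2) have "p' u * q u - p u * q' u = 0" by simp
    then have "u \<in> R" using sub[of u] u by (simp add: R_def)
    with * u(1,2) show False by blast
  qed
  then have Z: "finite Z \<and> card Z \<le> Suc (card (Q \<union> R))"
    using fin by (intro card_le_Suc_card_separators) auto
  have sub: "{x\<in>I. p x = 0} \<subseteq> Z \<union> Q" by (auto simp: Z_def)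
  then show "finite {x\<in>I. p x = 0}" using Z fin by (meson finite_Un finite_subset)
  have "card {x\<in>I. p x = 0} \<le> card (Z \<union> Q)" using sub Z fin by (intro card_mono) auto
  also have "\<dots> \<le> card Z + card Q" by (rule card_Un_le)
  also have "card Z \<le> Suc (card Q + card R)" using Z card_Un_le[of Q R] by simp
  finally show "card {x\<in>I. p x = 0} \<le> Suc (2 * card Q + card R)" by simp
qed

text \<open>Near \<open>z\<close> the quotient p / q has derivative 0, so it is constant with value
  0, and p vanishes on a whole neighbourhood.\<close>

lemma infinite_zeros_of_constant_quotient:
  fixes p q p' q' :: "real \<Rightarrow> real"
  assumes I: "open I"
    and p: "\<And>x. x \<in> I \<Longrightarrow> (p has_real_derivative p' x) (at x)"
    and q: "\<And>x. x \<in> I \<Longrightarrow> (q has_real_derivative q' x) (at x)"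
    and const: "\<And>x. x \<in> I \<Longrightarrow> p' x * q x - p x * q' x = 0"
    and z: "z \<in> I" "p z = 0" "q z \<noteq> 0"
  shows "infinite {x\<in>I. p x = 0}"
proof -
  have "(q \<longlongrightarrow> q z) (nhds z)"
    using DERIV_isCont[OF q[OF z(1)]] by (simp add: isCont_def tendsto_nhds_iff)
  then have "\<forall>\<^sub>F x in nhds z. q x \<noteq> 0"
    using z(3) by (rule tendsto_imp_eventually_ne)
  moreover have "\<forall>\<^sub>F x in nhds z. x \<in> I"
    by (rule eventually_nhds_in_open[OF I z(1)])
  ultimately have "\<forall>\<^sub>F x in nhds z. q x \<noteq> 0 \<and> x \<in> I"
    by (rule eventually_conj)
  then obtain e where e: "e > 0" "\<And>x. dist x z < e \<Longrightarrow> q x \<noteq> 0 \<and> x \<in> I"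
    by (auto simp: eventually_nhds_metric)
  have "\<exists>c. \<forall>x\<in>ball z e. p x / q x = c"
  proof (rule has_field_derivative_zero_constant)
    fix x assume "x \<in> ball z e"
    then have x: "q x \<noteq> 0" "x \<in> I" using e(2)[of x] by (auto simp: dist_commute)
    have "((\<lambda>x. p x / q x) has_real_derivative 0) (at x)"
      using DERIV_divide[OF p[OF x(2)] q[OF x(2)] x(1)] const[OF x(2)] by simp
    then show "((\<lambda>x. p x / q x) has_real_derivative 0) (at x within ball z e)"
      by (rule has_field_derivative_at_within)
  qed simp
  then obtain c where c: "\<And>x. x \<in> ball z e \<Longrightarrow> p x / q x = c" by blast
  have "c = 0" using c[of z] e(1) z(2) by simp
  have "ball z e \<subseteq> {x\<in>I. p x = 0}"
  proof
    fix x assume x: "x \<in> ball z e"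
    with c[OF x] \<open>c = 0\<close> e(2)[of x] show "x \<in> {x\<in>I. p x = 0}" by (auto simp: dist_commute)
  qed
  moreover have "infinite (ball z e)"
    using e(1) by (simp add: ball_eq_greaterThanLessThan)
  ultimately show ?thesis using finite_subset by blast
qed

text \<open>Arcs are graphs over open intervals that avoid the axes, singular points and vertical
  tangents. Disjointness makes the zeros on the arcs add up.\<close>

locale arc_system =
  fixes F :: "real poly poly" and \<Omega> :: "'i set" and I :: "'i \<Rightarrow> real set" and \<phi> :: "'i \<Rightarrow> real \<Rightarrow> real"
  assumes finite_index: "finite \<Omega>"
    and open_dom: "i \<in> \<Omega> \<Longrightarrow> open (I i)"
    and interval_dom: "i \<in> \<Omega> \<Longrightarrow> is_interval (I i)"
    and on_curve: "i \<in> \<Omega> \<Longrightarrow> x \<in> I i \<Longrightarrow> bipoly_eval F x (\<phi> i x) = 0"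
    and nondegenerate: "i \<in> \<Omega> \<Longrightarrow> x \<in> I i \<Longrightarrow> x * \<phi> i x * bipoly_eval (dY F) x (\<phi> i x) \<noteq> 0"
    and arc_deriv: "i \<in> \<Omega> \<Longrightarrow> x \<in> I i \<Longrightarrow> (\<phi> i has_real_derivative
      - bipoly_eval (dX F) x (\<phi> i x) / bipoly_eval (dY F) x (\<phi> i x)) (at x)"
    and disjoint: "i \<in> \<Omega> \<Longrightarrow> j \<in> \<Omega> \<Longrightarrow> i \<noteq> j \<Longrightarrow> x \<in> I i \<Longrightarrow> x \<in> I j \<Longrightarrow> \<phi> i x \<noteq> \<phi> j x"
begin

definition arc_zeros :: "real poly poly \<Rightarrow> (real \<times> real) set" where
  "arc_zeros P = (\<Union>i\<in>\<Omega>. (\<lambda>x. (x, \<phi> i x)) ` {x\<in>I i. bipoly_eval P x (\<phi> i x) = 0})"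

lemma finite_arc_zeros_iff:
  "finite (arc_zeros P) \<longleftrightarrow> (\<forall>i\<in>\<Omega>. finite {x\<in>I i. bipoly_eval P x (\<phi> i x) = 0})"
  unfolding arc_zeros_def using finite_index
  by (simp add: finite_image_iff inj_on_def)

lemma card_arc_zeros:
  assumes "finite (arc_zeros P)"
  shows "card (arc_zeros P) = (\<Sum>i\<in>\<Omega>. card {x\<in>I i. bipoly_eval P x (\<phi> i x) = 0})"
  unfolding arc_zeros_def
  by (subst card_UN_disjoint)
     (use assms disjoint finite_index in \<open>auto simp: finite_arc_zeros_iff card_image inj_on_def\<close>)

lemma arc_zeros_subset: "arc_zeros P \<subseteq> {(x, y). bipoly_eval F x y = 0 \<and> bipoly_eval P x y = 0}"
  using on_curve by (auto simp: arc_zeros_def)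

lemma finite_arc_zeros:
  assumes "prime_elem F" "\<not> F dvd P"
  shows "finite (arc_zeros P)" "card (arc_zeros P) \<le> total_degree F * total_degree P"
  using finite_subset[OF arc_zeros_subset bezout(1)[OF assms]]
    order.trans[OF card_mono[OF bezout(1)[OF assms] arc_zeros_subset] bezout(2)[OF assms]] by auto

lemma derivative_along_arc:
  assumes "i \<in> \<Omega>" "x \<in> I i"
  shows "((\<lambda>x. bipoly_eval P x (\<phi> i x)) has_real_derivative
    bipoly_eval (hamD F P) x (\<phi> i x) / (x * \<phi> i x * bipoly_eval (dY F) x (\<phi> i x))) (at x)"
proof -
  have "bipoly_eval (dX P) x (\<phi> i x) * 1 + bipoly_eval (dY P) x (\<phi> i x) *
      (- bipoly_eval (dX F) x (\<phi> i x) / bipoly_eval (dY F) x (\<phi> i x)) =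
    bipoly_eval (hamD F P) x (\<phi> i x) / (x * \<phi> i x * bipoly_eval (dY F) x (\<phi> i x))"
    using nondegenerate[OF assms] by (simp add: bipoly_eval_hamD field_simps)
  then show ?thesis
    using bipoly_eval_has_derivative[OF DERIV_ident arc_deriv[OF assms], of P] by simp
qed

text \<open>\<open>R\<close> is the numerator of the derivative of P / Q. Rolle costs one extra zero
  on each arc, which gives \<open>card \<Omega>\<close>.\<close>

lemma rolle_along_arcs:
  assumes R: "R = Q * hamD F P - P * hamD F Q"
    and fin: "finite (arc_zeros Q)" "finite (arc_zeros R)"
  shows "card (arc_zeros P) \<le> card \<Omega> + 2 * card (arc_zeros Q) + card (arc_zeros R)"
proof -
  define n where "n P i = card {x\<in>I i. bipoly_eval P x (\<phi> i x) = 0}" for P i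
  have step: "finite {x\<in>I i. bipoly_eval P x (\<phi> i x) = 0} \<and> n P i \<le> Suc (2 * n Q i + n R i)" if i: "i \<in> \<Omega>" for i
  proof -
    define h where "h x = x * \<phi> i x * bipoly_eval (dY F) x (\<phi> i x)" for x
    have h: "h x \<noteq> 0" if "x \<in> I i" for x
      unfolding h_def by (rule nondegenerate[OF i that])
    \<comment> \<open>Differentiation along the arc is \<open>hamD F\<close> divided by
      \<open>h\<close>; the common nonzero divisor does not change the zero set.\<close>
    have R_eq: "{x\<in>I i. bipoly_eval (hamD F P) x (\<phi> i x) / h x * bipoly_eval Q x (\<phi> i x) -
        bipoly_eval P x (\<phi> i x) * (bipoly_eval (hamD F Q) x (\<phi> i x) / h x) = 0} =
        {x\<in>I i. bipoly_eval R x (\<phi> i x) = 0}"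
    proof (rule Collect_cong, rule conj_cong[OF refl])
      fix x assume "x \<in> I i"
      have "bipoly_eval (hamD F P) x (\<phi> i x) / h x * bipoly_eval Q x (\<phi> i x) -
        bipoly_eval P x (\<phi> i x) * (bipoly_eval (hamD F Q) x (\<phi> i x) / h x) = bipoly_eval R x (\<phi> i x) / h x"
        unfolding R by (simp add: diff_divide_distrib mult.commute)
      then show "(bipoly_eval (hamD F P) x (\<phi> i x) / h x * bipoly_eval Q x (\<phi> i x) -
        bipoly_eval P x (\<phi> i x) * (bipoly_eval (hamD F Q) x (\<phi> i x) / h x) = 0) \<longleftrightarrow> bipoly_eval R x (\<phi> i x) = 0"
        using h[OF \<open>x \<in> I i\<close>] by simp
    qed
    have "finite {x\<in>I i. bipoly_eval Q x (\<phi> i x) = 0}" "finite {x\<in>I i. bipoly_eval R x (\<phi> i x) = 0}"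
      using fin i by (auto simp: finite_arc_zeros_iff)
    then show ?thesis
      using card_zeros_le_rolle_quotient[OF interval_dom[OF i]
          derivative_along_arc[OF i, of _ P] derivative_along_arc[OF i, of _ Q]]
      unfolding h_def[symmetric] R_eq n_def by blast
  qed
  then have finP: "finite (arc_zeros P)" by (simp add: finite_arc_zeros_iff)
  have "card (arc_zeros P) = (\<Sum>i\<in>\<Omega>. n P i)"
    unfolding card_arc_zeros[OF finP] n_def ..
  also have "\<dots> \<le> (\<Sum>i\<in>\<Omega>. Suc (2 * n Q i + n R i))"
    using step by (intro sum_mono) blast
  also have "\<dots> = card \<Omega> + 2 * (\<Sum>i\<in>\<Omega>. n Q i) + (\<Sum>i\<in>\<Omega>. n R i)"
    by (simp add: sum.distrib sum_distrib_left sum_Suc)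
  also have "\<dots> = card \<Omega> + 2 * card (arc_zeros Q) + card (arc_zeros R)"
    unfolding card_arc_zeros[OF fin(1)] card_arc_zeros[OF fin(2)] n_def ..
  finally show ?thesis .
qed

text \<open>The quotient P / Q is locally constant on the arcs off the zeros of \<open>Q\<close>, so
  a zero of \<open>P\<close> there would spread to infinitely many, against
  \<open>fin\<close>.\<close>

lemma arc_zeros_of_constant_quotient:
  assumes R: "F dvd Q * hamD F P - P * hamD F Q" and fin: "finite (arc_zeros P)"
  shows "arc_zeros P \<subseteq> arc_zeros Q"
proof
  fix w assume "w \<in> arc_zeros P"
  then obtain i z where iz: "i \<in> \<Omega>" "z \<in> I i" "bipoly_eval P z (\<phi> i z) = 0" "w = (z, \<phi> i z)"
    by (auto simp: arc_zeros_def)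
  have "bipoly_eval Q z (\<phi> i z) = 0"
  proof (rule ccontr)
    assume nz: "bipoly_eval Q z (\<phi> i z) \<noteq> 0"
    have "infinite {x\<in>I i. bipoly_eval P x (\<phi> i x) = 0}"
    proof (rule infinite_zeros_of_constant_quotient[OF open_dom[OF iz(1)]
          derivative_along_arc[OF iz(1), of _ P] derivative_along_arc[OF iz(1), of _ Q] _ iz(2,3) nz])
      fix x assume x: "x \<in> I i"
      obtain S where "Q * hamD F P - P * hamD F Q = F * S" using R by (rule dvdE)
      then have "bipoly_eval (Q * hamD F P - P * hamD F Q) x (\<phi> i x) = 0"
        using on_curve[OF iz(1) x] by simp
      then show "bipoly_eval (hamD F P) x (\<phi> i x) / (x * \<phi> i x * bipoly_eval (dY F) x (\<phi> i x)) *
          bipoly_eval Q x (\<phi> i x) - bipoly_eval P x (\<phi> i x) *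
          (bipoly_eval (hamD F Q) x (\<phi> i x) / (x * \<phi> i x * bipoly_eval (dY F) x (\<phi> i x))) = 0"
        by (simp add: mult.commute flip: diff_divide_distrib)
    qed
    then show False using fin iz(1) by (auto simp: finite_arc_zeros_iff)
  qed
  with iz show "w \<in> arc_zeros Q" by (auto simp: arc_zeros_def)
qed

text \<open>The monomial factor has no zero on an arc, since both coordinates are nonzero there;
  Bezout bounds the zeros of the cofactor \<open>T\<close>.\<close>

lemma card_arc_zeros_wronskian_monomials:
  assumes F: "prime_elem F" and ndvd: "\<not> F dvd ham.wronskian F (map mono_poly ps)"
    and d: "total_degree F \<ge> 1"
  shows "card (arc_zeros (ham.wronskian F (map mono_poly ps))) \<le>
    total_degree F * (length ps * (length ps * total_degree F))"
proof -
  obtain T where T: "ham.wronskian F (map mono_poly ps) = (\<Prod>j<length ps. mono_poly (ps ! j)) * T"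
      "total_degree T \<le> length ps * (length ps * total_degree F)"
    using wronskian_monomials[OF d] by blast
  have "\<not> F dvd T" using ndvd unfolding T(1) by auto
  note fin = finite_arc_zeros[OF F this]
  have "bipoly_eval T x (\<phi> i x) = 0"
    if "i \<in> \<Omega>" "x \<in> I i" "bipoly_eval (ham.wronskian F (map mono_poly ps)) x (\<phi> i x) = 0" for i x
    using that(3) nondegenerate[OF that(1,2)] unfolding T(1) by (auto simp: mono_poly_def)
  then have "arc_zeros (ham.wronskian F (map mono_poly ps)) \<subseteq> arc_zeros T"
    by (auto simp: arc_zeros_def)
  then have "card (arc_zeros (ham.wronskian F (map mono_poly ps))) \<le> card (arc_zeros T)"
    using fin(1) by (rule card_mono[rotated])
  also have "\<dots> \<le> total_degree F * (length ps * (length ps * total_degree F))"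
    using fin(2) T(2) by (meson mult_le_mono2 order.trans)
  finally show ?thesis .
qed

theorem card_arc_zeros_sparse:
  assumes F: "prime_elem F" and d: "total_degree F \<ge> 1"
    and M: "finite M" "card M \<le> t" and G: "G = (\<Sum>p\<in>M. Polynomial.smult [:c p:] (mono_poly p))"
    and ndvd: "\<not> F dvd G"
  shows "card (arc_zeros G) \<le> t * (card \<Omega> + 3 * (total_degree F * (t * (t * total_degree F))))"
proof -
  obtain ps where ps: "length ps \<le> card M"
    "\<And>s. s \<le> length ps \<Longrightarrow> \<not> F dvd ham.wronskian F (map mono_poly (take s ps))"
    "F dvd ham.wronskian F (map mono_poly ps @ [G])"
    using ex_maximal_independent_monomials[OF F M(1) G] by blast
  define W where "W s = ham.wronskian F (map mono_poly (take s ps))" for s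
  define g where "g s = ham.wronskian F (map mono_poly (take s ps) @ [G])" for s
  define w where "w = total_degree F * (t * (t * total_degree F))"
  have W: "finite (arc_zeros (W s))" "card (arc_zeros (W s)) \<le> w" if s: "s \<le> length ps" for s
  proof -
    show "finite (arc_zeros (W s))"
      unfolding W_def by (rule finite_arc_zeros[OF F ps(2)[OF s]])
    have "length (take s ps) \<le> t" using ps(1) M(2) by simp
    with card_arc_zeros_wronskian_monomials[OF F ps(2)[OF s] d]
    show "card (arc_zeros (W s)) \<le> w"
      unfolding W_def w_def by (meson mult_le_mono order.refl order.trans)
  qed
  have g0: "g 0 = G"
    unfolding g_def ham.wronskian_def by (simp add: det_1x1[simplified])
  \<comment> \<open>By minimality no earlier \<open>g s\<close> is divisible by \<open>F\<close>, so
    each has finitely many zeros on the curve. It is positive because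
    \<open>g 0 = G\<close>.\<close>
  define s0 where "s0 = (LEAST s. F dvd g s)"
  have "F dvd g (length ps)" using ps(3) by (simp add: g_def)
  then have s0: "F dvd g s0" "s0 \<le> length ps" "\<And>s. s < s0 \<Longrightarrow> \<not> F dvd g s"
    unfolding s0_def by (auto intro: LeastI Least_le dest: not_less_Least)
  have identity: "W (Suc s) * hamD F (g s) - g s * hamD F (W (Suc s)) = g (Suc s) * W s"
    if "s < length ps" for s
  proof -
    have "W s \<noteq> 0" using ps(2)[of s] that by (auto simp: W_def)
    then show ?thesis
      using ham.wronskian_identity[of F "map mono_poly (take s ps)" "mono_poly (ps ! s)" G] that
      by (simp add: W_def g_def take_Suc_conv_app_nth)
  qed
  have "s0 > 0" using s0(1) ndvd g0 by (metis gr0I)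
  \<comment> \<open>Descent from \<open>s0\<close>. At the start the identity has a right-hand side
    divisible by \<open>F\<close>, so the zeros are among those of \<open>W s0\<close>. Each later
    Rolle step costs \<open>card \<Omega>\<close>, twice the zeros of \<open>W (Suc s)\<close> and
    once those of \<open>W s\<close>, at most \<open>card \<Omega> + 3 * w\<close>.\<close>
  have "card (arc_zeros (g (s0 - Suc k))) \<le> Suc k * (card \<Omega> + 3 * w)" if "k < s0" for k
    using that
  proof (induction k)
    case 0
    let ?s = "s0 - 1"
    have s: "Suc ?s = s0" "?s < length ps" "?s < s0" using \<open>s0 > 0\<close> s0(2) by auto
    have "arc_zeros (g ?s) \<subseteq> arc_zeros (W s0)"
      using identity[OF s(2)] s0(1) finite_arc_zeros(1)[OF F s0(3)[OF s(3)]] unfolding s(1)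
      by (intro arc_zeros_of_constant_quotient) auto
    then have "card (arc_zeros (g ?s)) \<le> w"
      using W[OF s0(2)] by (meson card_mono order.trans)
    then show ?case by simp
  next
    case (Suc k)
    let ?s = "s0 - Suc (Suc k)"
    have s: "Suc ?s = s0 - Suc k" "?s < length ps" "Suc ?s \<le> length ps" "Suc ?s < s0"
      using Suc.prems s0(2) by auto
    have sub: "arc_zeros (g (Suc ?s) * W ?s) \<subseteq> arc_zeros (g (Suc ?s)) \<union> arc_zeros (W ?s)"
      by (auto simp: arc_zeros_def)
    have fin: "finite (arc_zeros (g (Suc ?s)))" "finite (arc_zeros (W ?s))"
      using finite_arc_zeros(1)[OF F s0(3)[OF s(4)]] W(1)[of ?s] s(2) by auto
    then have fin': "finite (arc_zeros (g (Suc ?s) * W ?s))"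
      using sub by (meson finite_Un finite_subset)
    have "card (arc_zeros (g (Suc ?s) * W ?s)) \<le> card (arc_zeros (g (Suc ?s)) \<union> arc_zeros (W ?s))"
      using sub fin by (intro card_mono) auto
    also have "\<dots> \<le> card (arc_zeros (g (Suc ?s))) + card (arc_zeros (W ?s))"
      by (rule card_Un_le)
    also have "card (arc_zeros (W ?s)) \<le> w" using W(2)[of ?s] s(2) by simp
    also have "card (arc_zeros (g (Suc ?s))) \<le> Suc k * (card \<Omega> + 3 * w)"
      unfolding s(1) using Suc by simp
    finally have "card (arc_zeros (g (Suc ?s) * W ?s)) \<le> Suc k * (card \<Omega> + 3 * w) + w"
      by simp
    moreover have "card (arc_zeros (g ?s)) \<le>
        card \<Omega> + 2 * card (arc_zeros (W (Suc ?s))) + card (arc_zeros (g (Suc ?s) * W ?s))"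
      by (rule rolle_along_arcs[OF identity[OF s(2), symmetric] W(1)[OF s(3)] fin'])
    moreover have "card (arc_zeros (W (Suc ?s))) \<le> w" by (rule W(2)[OF s(3)])
    ultimately show ?case by simp
  qed
  from this[of "s0 - 1"] \<open>s0 > 0\<close> have "card (arc_zeros G) \<le> s0 * (card \<Omega> + 3 * w)"
    by (simp add: g0)
  also have "\<dots> \<le> t * (card \<Omega> + 3 * w)"
    using s0(2) ps(1) M(2) by (intro mult_right_mono) auto
  finally show ?thesis by (simp add: w_def)
qed

end

section \<open>Covers by connected sets\<close>

text \<open>A substitute for counting components that is additive under unions and stable under
  continuous images; the covering sets may overlap.\<close>

definition conn_cover :: "'a::topological_space set \<Rightarrow> nat \<Rightarrow> bool" where
  "conn_cover S n \<longleftrightarrow> (\<exists>\<C>. finite \<C> \<and> card \<C> \<le> n \<and> (\<forall>c\<in>\<C>. connected c) \<and> \<Union>\<C> = S)"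

text \<open>Every component contains a nonempty member of the cover and is the component of any
  point of it, so choosing a point in each member reaches all components.\<close>

lemma conn_cover_components:
  assumes "conn_cover S n"
  shows "finite (components S)" "card (components S) \<le> n"
proof -
  obtain \<C> where \<C>: "finite \<C>" "card \<C> \<le> n" "\<And>c. c \<in> \<C> \<Longrightarrow> connected c" "\<Union>\<C> = S"
    using assms by (auto simp: conn_cover_def)
  have sub: "components S \<subseteq> (\<lambda>c. connected_component_set S (SOME p. p \<in> c)) ` \<C>"
  proof
    fix C assume "C \<in> components S"
    then obtain x where x: "x \<in> S" "C = connected_component_set S x"
      by (auto simp: components_def)
    then obtain c where c: "c \<in> \<C>" "x \<in> c" using \<C>(4) by blast
    define p where "p = (SOME p. p \<in> c)"
    have "p \<in> c" unfolding p_def using c(2) by (rule someI)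
    moreover have "c \<subseteq> S" using c(1) \<C>(4) by blast
    ultimately have "connected_component S x p"
      using \<C>(3)[OF c(1)] c(2) by (auto simp: connected_component_def)
    then have "C = connected_component_set S p"
      unfolding x(2) by (simp add: connected_component_eq_eq connected_component_eq)
    with c(1) show "C \<in> (\<lambda>c. connected_component_set S (SOME p. p \<in> c)) ` \<C>"
      unfolding p_def by blast
  qed
  show "finite (components S)" by (rule finite_subset[OF sub]) (simp add: \<C>(1))
  show "card (components S) \<le> n" using surj_card_le[OF \<C>(1) sub] \<C>(2) by simp
qed

lemma conn_cover_mono: "conn_cover S m \<Longrightarrow> m \<le> n \<Longrightarrow> conn_cover S n"
  unfolding conn_cover_def by (elim exE, rule exI) auto

lemma conn_cover_connected: "connected S \<Longrightarrow> conn_cover S 1"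
  unfolding conn_cover_def by (intro exI[of _ "{S}"]) auto

lemma conn_cover_empty: "conn_cover {} n"
  unfolding conn_cover_def by (intro exI[of _ "{}"]) auto

lemma conn_cover_Un:
  assumes "conn_cover S m" "conn_cover T n"
  shows "conn_cover (S \<union> T) (m + n)"
proof -
  obtain \<C> \<D> where "finite \<C>" "card \<C> \<le> m" "\<forall>c\<in>\<C>. connected c" "\<Union>\<C> = S"
    "finite \<D>" "card \<D> \<le> n" "\<forall>c\<in>\<D>. connected c" "\<Union>\<D> = T"
    using assms by (auto simp: conn_cover_def)
  then show ?thesis
    unfolding conn_cover_def using card_Un_le[of \<C> \<D>]
    by (intro exI[of _ "\<C> \<union> \<D>"]) auto
qed

lemma conn_cover_UN:
  assumes "finite A" "\<And>i. i \<in> A \<Longrightarrow> conn_cover (S i) n"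
  shows "conn_cover (\<Union>i\<in>A. S i) (card A * n)"
  using assms
proof (induction A rule: finite_induct)
  case (insert x A)
  then have "conn_cover (S x \<union> (\<Union>i\<in>A. S i)) (n + card A * n)"
    by (intro conn_cover_Un) auto
  with insert show ?case by simp
qed (simp add: conn_cover_empty)

lemma conn_cover_finite: "finite S \<Longrightarrow> conn_cover S (card S)"
  using conn_cover_UN[OF _ conn_cover_connected[OF connected_sing], of S "\<lambda>x. x"] by simp

lemma conn_cover_image:
  assumes "conn_cover S n" "continuous_on S f"
  shows "conn_cover (f ` S) n"
proof -
  obtain \<C> where \<C>: "finite \<C>" "card \<C> \<le> n" "\<And>c. c \<in> \<C> \<Longrightarrow> connected c" "\<Union>\<C> = S"
    using assms by (auto simp: conn_cover_def)
  have "connected (f ` c)" if "c \<in> \<C>" for c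
    using \<C>(3)[OF that] \<C>(4) that assms(2)
    by (intro connected_continuous_image continuous_on_subset[OF assms(2)]) auto
  moreover have "card ((`) f ` \<C>) \<le> n"
    using card_image_le[OF \<C>(1), of "(`) f"] \<C>(2) by simp
  ultimately show ?thesis
    unfolding conn_cover_def using \<C>(1,4) by (intro exI[of _ "(`) f ` \<C>"]) auto
qed

section \<open>Curves contained in lines\<close>

text \<open>A weak form of Descartes' rule. Dividing by a power of X makes the constant term
  nonzero; differentiation removes it, and Rolle costs one zero. The possible zero at 0 costs
  another, so each term accounts for two.\<close>

lemma card_zeros_sparse_poly:
  fixes p :: "real poly"
  assumes "p \<noteq> 0" "card {i. coeff p i \<noteq> 0} \<le> t"
  shows "card {x. poly p x = 0} \<le> 2 * t"
  using assms
proof (induction t arbitrary: p)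
  case 0
  have "finite {i. coeff p i \<noteq> 0}"
    by (rule finite_subset[of _ "{..degree p}"]) (auto intro: le_degree)
  moreover have "degree p \<in> {i. coeff p i \<noteq> 0}" using 0 by simp
  ultimately show ?case using 0(2) by (metis card_0_eq emptyE le_zero_eq)
next
  case (Suc t)
  define k where "k = order 0 p"
  obtain q where q: "p = [:- 0, 1:] ^ k * q" "\<not> [:- 0, 1:] dvd q"
    using order_decomp[OF Suc.prems(1), of 0] unfolding k_def by blast
  have coeff_p: "coeff p (i + k) = coeff q i" for i
  proof -
    have "p = monom 1 k * q" using q(1) by (simp add: monom_altdef)
    then show ?thesis by (simp add: coeff_monom_mult)
  qed
  have fin: "finite {i. coeff r i \<noteq> 0}" for r :: "real poly"
    by (rule finite_subset[of _ "{..degree r}"]) (auto intro: le_degree)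
  have "card {i. coeff q i \<noteq> 0} = card ((\<lambda>i. i + k) ` {i. coeff q i \<noteq> 0})"
    by (rule card_image[symmetric]) simp
  also have "\<dots> \<le> card {i. coeff p i \<noteq> 0}"
    using coeff_p by (intro card_mono fin) auto
  finally have card_q: "card {i. coeff q i \<noteq> 0} \<le> Suc t" using Suc.prems(2) by simp
  have q0: "coeff q 0 \<noteq> 0"
    using q(2) poly_eq_0_iff_dvd[of q 0] by (simp add: poly_0_coeff_0)
  have "finite {x. poly q x = 0} \<and> card {x. poly q x = 0} \<le> Suc (2 * t)"
  proof (cases "pderiv q = 0")
    case True
    then obtain c where "q = [:c:]" by (metis pderiv_iszero)
    with q0 show ?thesis by simp
  next
    case False
    have "Suc ` {i. coeff (pderiv q) i \<noteq> 0} \<subseteq> {i. coeff q i \<noteq> 0} - {0}"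
      by (auto simp: coeff_pderiv)
    then have "card (Suc ` {i. coeff (pderiv q) i \<noteq> 0}) \<le> card ({i. coeff q i \<noteq> 0} - {0})"
      by (intro card_mono) (use fin in auto)
    then have "card {i. coeff (pderiv q) i \<noteq> 0} \<le> t"
      using card_q q0 fin[of q] by (simp add: card_image card_Diff_singleton)
    then have IH: "card {x. poly (pderiv q) x = 0} \<le> 2 * t"
      by (rule Suc.IH[OF False])
    have "finite {x. poly q x = 0} \<and> card {x. poly q x = 0} \<le> Suc (card {x. poly (pderiv q) x = 0})"
    proof (rule card_le_Suc_card_separators)
      show "finite {x. poly (pderiv q) x = 0}" by (rule poly_roots_finite[OF False])
      fix z z' assume "z \<in> {x. poly q x = 0}" "z' \<in> {x. poly q x = 0}" "z < z'"
      with poly_MVT[of z z' q] show "\<exists>u\<in>{x. poly (pderiv q) x = 0}. z < u \<and> u < z'" by auto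
    qed
    with IH show ?thesis by simp
  qed
  moreover have "{x. poly p x = 0} \<subseteq> insert 0 {x. poly q x = 0}"
    using q(1) by auto
  ultimately show ?case
    using card_mono[of "insert 0 {x. poly q x = 0}" "{x. poly p x = 0}"]
    by (simp add: card_insert_if split: if_splits)
qed

text \<open>The zero polynomial contributes the whole line, a single connected set;
  \<open>t \<ge> 1\<close> leaves room for it.\<close>

lemma conn_cover_zeros_sparse_poly:
  fixes p :: "real poly"
  assumes "card {i. coeff p i \<noteq> 0} \<le> t" "t \<ge> 1"
  shows "conn_cover {x. poly p x = 0} (2 * t)"
proof (cases "p = 0")
  case True
  then have "conn_cover {x. poly p x = 0} 1"
    using conn_cover_connected[of "UNIV :: real set"] by simp
  then show ?thesis by (rule conn_cover_mono) (use assms(2) in simp)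
next
  case False
  show ?thesis
    by (rule conn_cover_mono[OF conn_cover_finite[OF poly_roots_finite[OF False]]
          card_zeros_sparse_poly[OF False assms(1)]])
qed

definition common_zeros :: "real poly poly \<Rightarrow> real poly poly \<Rightarrow> (real \<times> real) set" where
  "common_zeros F G = {(x, y). bipoly_eval F x y = 0 \<and> bipoly_eval G x y = 0}"

text \<open>The curve is a finite union of vertical lines, and restricting \<open>G\<close> to one
  of them only merges or cancels terms.\<close>

lemma conn_cover_vertical:
  assumes F: "F = [:f:]" "f \<noteq> 0" and t: "t \<ge> 1" "t_sparse t G"
  shows "conn_cover (common_zeros F G) (degree f * (2 * t))"
proof -
  define r where "r c = map_poly (\<lambda>q. poly q c) G" for c
  have "{b. coeff (r c) b \<noteq> 0} \<subseteq> snd ` bipoly_support G" for c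
  proof
    fix b assume "b \<in> {b. coeff (r c) b \<noteq> 0}"
    then have "coeff G b \<noteq> 0" by (auto simp: r_def coeff_map_poly)
    then obtain a where "coeff (coeff G b) a \<noteq> 0" using leading_coeff_neq_0 by blast
    then show "b \<in> snd ` bipoly_support G" by (force simp: bipoly_support_def)
  qed
  then have "card {b. coeff (r c) b \<noteq> 0} \<le> t" for c
    using surj_card_le[OF finite_bipoly_support] t(2) unfolding t_sparse_def by (meson order.trans)
  then have "conn_cover (Pair c ` {y. poly (r c) y = 0}) (2 * t)" for c
    using t(1) by (intro conn_cover_image conn_cover_zeros_sparse_poly continuous_intros) auto
  then have "conn_cover (\<Union>c\<in>{c. poly f c = 0}. Pair c ` {y. poly (r c) y = 0})
      (card {c. poly f c = 0} * (2 * t))"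
    by (intro conn_cover_UN poly_roots_finite[OF F(2)])
  also have "(\<Union>c\<in>{c. poly f c = 0}. Pair c ` {y. poly (r c) y = 0}) = common_zeros F G"
    by (auto simp: F(1) common_zeros_def r_def bipoly_eval_eq_poly_map_poly[of G])
  finally show ?thesis
    by (rule conn_cover_mono) (use card_poly_roots_bound[OF F(2)] in simp)
qed

text \<open>All zeros of \<open>F\<close> lie on the line Y = 0. Either \<open>F\<close> vanishes on
  that whole line, where \<open>G\<close> becomes a sparse univariate polynomial, or it has finitely
  many zeros there.\<close>

lemma conn_cover_horizontal:
  assumes F: "F dvd varY" and t: "t \<ge> 1" "t_sparse t G"
  shows "conn_cover (common_zeros F G) (total_degree F + 2 * t)"
proof -
  obtain K where K: "varY = F * K" using F by (rule dvdE)
  have y0: "y = 0" if "bipoly_eval F x y = 0" for x y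
    using arg_cong[OF K, of "\<lambda>P. bipoly_eval P x y"] that by simp
  have at0: "bipoly_eval P x 0 = poly (coeff P 0) x" for P and x :: real
    by (cases P) simp
  have "common_zeros F G = (\<lambda>x. (x, 0)) ` {x. bipoly_eval F x 0 = 0 \<and> bipoly_eval G x 0 = 0}"
    by (auto simp: common_zeros_def image_iff dest: y0)
  then have eq: "common_zeros F G = (\<lambda>x. (x, 0)) ` {x. poly (coeff F 0) x = 0 \<and> poly (coeff G 0) x = 0}"
    unfolding at0 .
  show ?thesis
  proof (cases "coeff F 0 = 0")
    case True
    have "{a. coeff (coeff G 0) a \<noteq> 0} \<subseteq> fst ` bipoly_support G"
      by (force simp: bipoly_support_def)
    then have "card {a. coeff (coeff G 0) a \<noteq> 0} \<le> t"
      using surj_card_le[OF finite_bipoly_support] t(2) unfolding t_sparse_def by (meson order.trans)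
    then have "conn_cover (common_zeros F G) (2 * t)"
      unfolding eq True using t(1)
      by (auto intro!: conn_cover_image conn_cover_zeros_sparse_poly continuous_intros)
    then show ?thesis by (rule conn_cover_mono) simp
  next
    case False
    have fin: "finite {x. poly (coeff F 0) x = 0}" by (rule poly_roots_finite[OF False])
    have "card (common_zeros F G) \<le> card {x. poly (coeff F 0) x = 0}"
      unfolding eq by (rule order.trans[OF card_image_le card_mono[OF fin]])
        (auto intro: finite_subset[OF _ fin])
    also have "\<dots> \<le> degree (coeff F 0)" by (rule card_poly_roots_bound[OF False])
    also have "\<dots> \<le> total_degree F" by (rule degree_coeff_le_total_degree)
    finally have "card (common_zeros F G) \<le> total_degree F + 2 * t" by simp
    moreover have "finite (common_zeros F G)"
      unfolding eq by (intro finite_imageI finite_subset[OF _ fin]) auto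
    ultimately show ?thesis using conn_cover_finite conn_cover_mono by blast
  qed
qed

section \<open>Cutting an irreducible curve into arcs\<close>

text \<open>For \<open>k \<le> card B\<close> these are the components of the complement of \<open>B\<close>, from left to right.\<close>
definition gap :: "real set \<Rightarrow> nat \<Rightarrow> real set" where
  "gap B k = {x. x \<notin> B \<and> card {b\<in>B. b < x} = k}"

lemma open_gap:
  assumes B: "finite B"
  shows "open (gap B k)"
proof -
  have "\<exists>T. open T \<and> x \<in> T \<and> T \<subseteq> gap B k" if x: "x \<in> gap B k" for x
  proof -
    have "\<forall>\<^sub>F z in nhds x. b \<noteq> z \<and> (b < z \<longleftrightarrow> b < x)" if "b \<in> B" for b
    proof (cases "b < x")
      case True
      then have "\<forall>\<^sub>F z in nhds x. z \<in> {b<..}" by (intro eventually_nhds_in_open) auto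
      then show ?thesis by eventually_elim (use True in auto)
    next
      case False
      with x that have "x < b" by (cases x b rule: linorder_cases) (auto simp: gap_def)
      then have "\<forall>\<^sub>F z in nhds x. z \<in> {..<b}" by (intro eventually_nhds_in_open) auto
      then show ?thesis by eventually_elim (use \<open>x < b\<close> in auto)
    qed
    then have "\<forall>\<^sub>F z in nhds x. \<forall>b\<in>B. b \<noteq> z \<and> (b < z \<longleftrightarrow> b < x)"
      by (intro eventually_ball_finite B) auto
    then have "\<forall>\<^sub>F z in nhds x. z \<in> gap B k"
    proof eventually_elim
      case (elim z)
      then have "{b\<in>B. b < z} = {b\<in>B. b < x}" by blast
      with elim x show ?case unfolding gap_def by auto
    qed
    then show ?thesis unfolding eventually_nhds by blast
  qed
  then show ?thesis by (subst open_subopen) blast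
qed

text \<open>The points of \<open>B\<close> below \<open>a\<close> and below \<open>b\<close> form
  nested finite sets of equal size, so no point of \<open>B\<close> lies between.\<close>

lemma is_interval_gap:
  assumes B: "finite B"
  shows "is_interval (gap B k)"
  unfolding is_interval_1
proof (intro allI ballI impI)
  fix a b x assume ab: "a \<in> gap B k" "b \<in> gap B k" and x: "a \<le> x \<and> x \<le> b"
  have "{c\<in>B. c < a} = {c\<in>B. c < b}"
    using ab x B by (intro card_subset_eq) (auto simp: gap_def)
  then have *: "c < a \<longleftrightarrow> c < b" if "c \<in> B" for c
    using that by blast
  then have "{c\<in>B. c < x} = {c\<in>B. c < a}"
    using x by force
  moreover have "x \<notin> B"
  proof
    assume "x \<in> B"
    then have "x < b" using x ab by (cases "x = b") (auto simp: gap_def)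
    with *[OF \<open>x \<in> B\<close>] x show False by simp
  qed
  ultimately show "x \<in> gap B k" using ab by (simp add: gap_def)
qed

text \<open>With d the degree of \<open>F\<close>, at most 3 d^2 exceptional abscissae carry at most
  3 d^3 points of the curve and leave at most 4 d^3 arcs; the constant is 3 + 4.\<close>

lemma conn_cover_irreducible:
  assumes irr: "irreducible F" and deg: "degree F \<ge> 1" and ndvdY: "\<not> F dvd varY"
    and t: "t \<ge> 1" "t_sparse t G"
  shows "conn_cover (common_zeros F G)
    (7 * (total_degree F ^ 3 * t + total_degree F ^ 2 * t ^ 3))"
proof -
  define d where "d = total_degree F"
  have F: "prime_elem F" by (rule irreducible_imp_prime_bipoly[OF irr])
  have "F \<noteq> 0" using F by auto
  have degd: "degree F \<le> d" unfolding d_def by (rule degree_le_total_degree)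
  with deg have d: "d \<ge> 1" by simp
  \<comment> \<open>On the curve \<open>K\<close> vanishes on the axes, at singular points and at
    vertical tangents. The prime \<open>F\<close> divides none of the three factors: for
    \<open>varX\<close> and \<open>dY F\<close> by comparing degrees in Y.\<close>
  define K where "K = varX * varY * dY F"
  have "\<not> F dvd varX"
    using deg by (auto dest: dvd_imp_degree_le)
  moreover have "\<not> F dvd dY F"
  proof
    assume "F dvd dY F"
    moreover have "dY F \<noteq> 0" using deg by (simp add: pderiv_eq_0_iff)
    ultimately have "degree F \<le> degree (dY F)" by (rule dvd_imp_degree_le)
    with deg show False by (simp add: degree_pderiv)
  qed
  ultimately have ndvdK: "\<not> F dvd K"
    unfolding K_def using F ndvdY prime_elem_dvd_multD by blast
  have "total_degree K \<le> (1 + 1) + (d - 1)"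
    unfolding K_def d_def
    by (intro order.trans[OF total_degree_mult_le add_mono[OF order.trans[OF total_degree_mult_le
        add_mono[OF total_degree_varX total_degree_varY]] total_degree_dY_le]])
  then have degK: "total_degree K \<le> d + 1" using d by simp
  \<comment> \<open>The zeros of the leading coefficient are added because a branch may escape to
    infinity there.\<close>
  define B where "B = {x. poly (lead_coeff F) x = 0} \<union> fst ` common_zeros F K"
  have lc0: "lead_coeff F \<noteq> 0" using \<open>F \<noteq> 0\<close> by simp
  have fin: "finite (common_zeros F K)" "card (common_zeros F K) \<le> d * (d + 1)"
    using bezout[OF F ndvdK] mult_le_mono2[OF degK, of d] unfolding common_zeros_def d_def
    by (blast intro: order.trans)+
  have finB: "finite B"
    unfolding B_def using fin poly_roots_finite[OF lc0] by simp
  have "card B \<le> card {x. poly (lead_coeff F) x = 0} + card (fst ` common_zeros F K)"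
    unfolding B_def by (rule card_Un_le)
  also have "card {x. poly (lead_coeff F) x = 0} \<le> d"
    unfolding d_def by (rule order.trans[OF card_poly_roots_bound[OF lc0] degree_coeff_le_total_degree])
  also have "card (fst ` common_zeros F K) \<le> d * (d + 1)"
    using card_image_le[OF fin(1), of fst] fin(2) by simp
  finally have "card B \<le> d + d * (d + 1)" by simp
  also have "\<dots> \<le> 3 * d ^ 2"
    using mult_le_mono2[OF d, of d] unfolding power2_eq_square distrib_left by linarith
  finally have cardB: "card B \<le> 3 * d ^ 2" .
  have good: "regular_over F x \<and> (\<forall>y. bipoly_eval F x y = 0 \<longrightarrow> x * y * bipoly_eval (dY F) x y \<noteq> 0)"
    if "x \<notin> B" for x
  proof -
    have "x * y * bipoly_eval (dY F) x y \<noteq> 0" if "bipoly_eval F x y = 0" for y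
    proof
      assume "x * y * bipoly_eval (dY F) x y = 0"
      then have "bipoly_eval K x y = 0" by (auto simp: K_def simp del: mult_pCons_left)
      with that have "(x, y) \<in> common_zeros F K" by (simp add: common_zeros_def)
      with \<open>x \<notin> B\<close> show False unfolding B_def by force
    qed
    with \<open>x \<notin> B\<close> show ?thesis by (auto simp: regular_over_def B_def)
  qed
  have "\<exists>N. N \<le> degree F \<and>
      (\<forall>x\<in>gap B k. bij_betw (\<lambda>j. branch F j x) {..<N} (roots_over F x)) \<and>
      (\<forall>x\<in>gap B k. \<forall>j<N. (branch F j has_real_derivative
        - bipoly_eval (dX F) x (branch F j x) / bipoly_eval (dY F) x (branch F j x)) (at x))" for k
  proof -
    have conn: "connected (gap B k)"
      using is_interval_gap[OF finB] by (simp add: is_interval_connected_1)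
    have reg: "regular_over F x" if "x \<in> gap B k" for x
      using good[of x] that by (simp add: gap_def)
    show ?thesis
      by (rule branches_over_interval[OF open_gap[OF finB] conn reg]) blast+
  qed
  then obtain N where N: "\<And>k. N k \<le> degree F"
      "\<And>k x. x \<in> gap B k \<Longrightarrow> bij_betw (\<lambda>j. branch F j x) {..<N k} (roots_over F x)"
      "\<And>k x j. x \<in> gap B k \<Longrightarrow> j < N k \<Longrightarrow> (branch F j has_real_derivative
        - bipoly_eval (dX F) x (branch F j x) / bipoly_eval (dY F) x (branch F j x)) (at x)"
    by metis
  \<comment> \<open>The closed range of indices reflects that n cut points leave n + 1 gaps.\<close>
  define \<Omega> where "\<Omega> = (SIGMA k:{..card B}. {..<N k})"
  define I where "I i = gap B (fst i)" for i :: "nat \<times> nat"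
  define \<phi> where "\<phi> i = branch F (snd i)" for i :: "nat \<times> nat"
  have root: "bipoly_eval F x (\<phi> i x) = 0" if "i \<in> \<Omega>" "x \<in> I i" for i x
    using N(2)[of x "fst i"] that by (auto simp: \<Omega>_def I_def \<phi>_def bij_betw_def roots_over_def)
  interpret arcs: arc_system F \<Omega> I \<phi>
  proof
    show "finite \<Omega>" by (auto simp: \<Omega>_def)
    fix i assume i: "i \<in> \<Omega>"
    show "open (I i)" "is_interval (I i)"
      unfolding I_def by (rule open_gap[OF finB], rule is_interval_gap[OF finB])
    fix x assume x: "x \<in> I i"
    show "bipoly_eval F x (\<phi> i x) = 0" by (rule root[OF i x])
    then show "x * \<phi> i x * bipoly_eval (dY F) x (\<phi> i x) \<noteq> 0"
      using good[of x] x by (auto simp: I_def gap_def)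
    show "(\<phi> i has_real_derivative
      - bipoly_eval (dX F) x (\<phi> i x) / bipoly_eval (dY F) x (\<phi> i x)) (at x)"
      using N(3)[of x "fst i" "snd i"] i x by (auto simp: \<Omega>_def I_def \<phi>_def)
    fix j assume j: "j \<in> \<Omega>" "i \<noteq> j" "x \<in> I j"
    then have "fst i = fst j" using x by (auto simp: I_def gap_def)
    with N(2)[of x "fst i"] i j x show "\<phi> i x \<noteq> \<phi> j x"
      by (auto simp: \<Omega>_def I_def \<phi>_def bij_betw_def inj_on_def prod_eq_iff)
  qed
  have "card \<Omega> = (\<Sum>k\<le>card B. N k)"
    by (simp add: \<Omega>_def card_SigmaI)
  also have "\<dots> \<le> (\<Sum>k\<le>card B. d)"
    using N(1) degd by (intro sum_mono) (meson order.trans)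
  also have "\<dots> = (card B + 1) * d" by simp
  also have "\<dots> \<le> (3 * d ^ 2 + d ^ 2) * d"
    using cardB d by (intro mult_right_mono add_mono) auto
  finally have card\<Omega>: "card \<Omega> \<le> 4 * d ^ 3" by (simp add: power2_eq_square power3_eq_cube)
  have covered: "\<exists>i\<in>\<Omega>. x \<in> I i \<and> y = \<phi> i x" if "bipoly_eval F x y = 0" "x \<notin> B" for x y
  proof -
    define k where "k = card {b\<in>B. b < x}"
    have x: "x \<in> gap B k" using that by (simp add: gap_def k_def)
    have "k \<le> card B" unfolding k_def using finB by (intro card_mono) auto
    moreover have "y \<in> roots_over F x" using that by (simp add: roots_over_def)
    then obtain j where "j < N k" "y = branch F j x"
      using N(2)[OF x] by (auto simp: bij_betw_def)
    ultimately show ?thesis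
      using x by (intro bexI[of _ "(k, j)"]) (auto simp: \<Omega>_def I_def \<phi>_def)
  qed
  have arc_in: "x \<notin> B" if "x \<in> I i" for i x using that by (simp add: I_def gap_def)
  define pts where "pts = {(x, y). x \<in> B \<and> bipoly_eval F x y = 0 \<and> bipoly_eval G x y = 0}"
  have split: "common_zeros F G = pts \<union> arcs.arc_zeros G"
    using covered root arc_in unfolding common_zeros_def pts_def arcs.arc_zeros_def by fastforce
  \<comment> \<open>A vertical line inside the curve would make X - b a factor, impossible for an
    irreducible \<open>F\<close> of positive degree in Y. Hence the fibres over \<open>B\<close> are
    finite too.\<close>
  have nonzero_fibre: "map_poly (\<lambda>c. poly c b) F \<noteq> 0" for b
  proof
    assume 0: "map_poly (\<lambda>c. poly c b) F = 0"
    have "poly (coeff F n) b = 0" for n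
      using arg_cong[OF 0, of "\<lambda>p. coeff p n"] by (simp add: coeff_map_poly)
    then have "[:[:- b, 1:]:] dvd F" by (simp add: const_poly_dvd_iff poly_eq_0_iff_dvd)
    then obtain u where u: "F = [:[:- b, 1:]:] * u" by (rule dvdE)
    have "\<not> is_unit [:[:- b, 1:]:]" by (simp add: is_unit_const_poly_iff is_unit_pCons_iff)
    with irreducibleD[OF irr u] have "is_unit u" by blast
    then have "degree u = 0"
      using degree_le_total_degree[of u] by (simp add: bipoly_is_unit_iff)
    with u deg show False by (simp add: degree_mult_eq split: if_splits)
  qed
  have "pts \<subseteq> (SIGMA x:B. roots_over F x)" by (auto simp: pts_def roots_over_def)
  moreover have "finite (SIGMA x:B. roots_over F x)"
    using finB roots_over_finite(1)[OF nonzero_fibre] by auto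
  moreover have "card (SIGMA x:B. roots_over F x) \<le> card B * d"
  proof -
    have "card (SIGMA x:B. roots_over F x) = (\<Sum>x\<in>B. card (roots_over F x))"
      using finB roots_over_finite(1)[OF nonzero_fibre] by (intro card_SigmaI) auto
    also have "\<dots> \<le> (\<Sum>x\<in>B. d)"
      by (intro sum_mono order.trans[OF roots_over_finite(2)[OF nonzero_fibre] degd])
    finally show ?thesis by simp
  qed
  ultimately have pts: "finite pts" "card pts \<le> card B * d"
    by (meson finite_subset, meson card_mono order.trans)
  note pts(2)
  also have "card B * d \<le> 3 * d ^ 2 * d" using cardB by (rule mult_right_mono) simp
  also have "\<dots> = 3 * d ^ 3" by (simp add: power2_eq_square power3_eq_cube)
  finally have card_pts: "card pts \<le> 3 * d ^ 3" .
  have d3: "d ^ 3 \<le> d ^ 3 * t" using t(1) by simp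
  have "\<exists>n. conn_cover (arcs.arc_zeros G) n \<and> n \<le> 4 * d ^ 3 * t + 3 * d ^ 2 * t ^ 3"
  proof (cases "F dvd G")
    case True
    then obtain H where H: "G = F * H" by (rule dvdE)
    \<comment> \<open>Here \<open>G\<close> vanishes on the entire curve, so the arcs are counted
      whole; each is a continuous graph over an interval.\<close>
    have "arcs.arc_zeros G = (\<Union>i\<in>\<Omega>. (\<lambda>x. (x, \<phi> i x)) ` I i)"
      unfolding arcs.arc_zeros_def using root H by (intro SUP_cong) auto
    also have "conn_cover \<dots> (card \<Omega> * 1)"
    proof (intro conn_cover_UN conn_cover_connected arcs.finite_index)
      fix i assume i: "i \<in> \<Omega>"
      have "continuous_on (I i) (\<phi> i)"
        using arcs.arc_deriv[OF i] DERIV_isCont by (blast intro: continuous_at_imp_continuous_on)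
      then show "connected ((\<lambda>x. (x, \<phi> i x)) ` I i)"
        using arcs.interval_dom[OF i]
        by (intro connected_continuous_image continuous_intros) (auto simp: is_interval_connected_1)
    qed
    finally have "conn_cover (arcs.arc_zeros G) (card \<Omega>)" by simp
    moreover have "card \<Omega> \<le> 4 * d ^ 3 * t + 3 * d ^ 2 * t ^ 3"
      using card\<Omega> d3 by linarith
    ultimately show ?thesis by blast
  next
    case False
    define c where "c p = coeff (coeff G (snd p)) (fst p)" for p
    have G: "G = (\<Sum>p\<in>bipoly_support G. Polynomial.smult [:c p:] (mono_poly p))"
      using bipoly_as_sum_of_monomials[of G] by (simp add: c_def mono_poly_def case_prod_unfold smult_monom)
    have "card (arcs.arc_zeros G) \<le> t * (card \<Omega> + 3 * (d * (t * (t * d))))"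
      using arcs.card_arc_zeros_sparse[OF F _ finite_bipoly_support _ G False] d t(2)
      unfolding d_def t_sparse_def by blast
    also have "\<dots> \<le> t * (4 * d ^ 3 + 3 * (d * (t * (t * d))))"
      using card\<Omega> by (intro mult_left_mono add_right_mono) auto
    also have "\<dots> = 4 * d ^ 3 * t + 3 * d ^ 2 * t ^ 3"
      by (simp add: algebra_simps power2_eq_square power3_eq_cube)
    finally show ?thesis
      using conn_cover_finite[OF arcs.finite_arc_zeros(1)[OF F False]] by blast
  qed
  then obtain n where n: "conn_cover (arcs.arc_zeros G) n" "n \<le> 4 * d ^ 3 * t + 3 * d ^ 2 * t ^ 3"
    by blast
  have "conn_cover (common_zeros F G) (card pts + n)"
    unfolding split by (intro conn_cover_Un conn_cover_finite pts n)
  moreover have "card pts + n \<le> 7 * (d ^ 3 * t + d ^ 2 * t ^ 3)"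
    using card_pts n(2) d3 unfolding distrib_left mult.assoc by linarith
  ultimately show ?thesis unfolding d_def by (rule conn_cover_mono)
qed

lemma conn_cover_common_zeros:
  assumes t: "t \<ge> 1" "t_sparse t G" and "F \<noteq> 0"
  shows "conn_cover (common_zeros F G) (7 * (total_degree F ^ 3 * t + total_degree F ^ 2 * t ^ 3))"
  using assms(3)
proof (induction "total_degree F" arbitrary: F rule: less_induct)
  case less
  define \<beta> where "\<beta> d = 7 * (d ^ 3 * t + d ^ 2 * t ^ 3)" for d
  define d where "d = total_degree F"
  have large: "d + 2 * t \<le> \<beta> d" "d * (2 * t) \<le> \<beta> d" if "d \<ge> 1"
  proof -
    have "d \<le> d ^ 3" using that by (simp add: self_le_power)
    then have "d * t \<le> d ^ 3 * t" by simp
    moreover have "d \<le> d * t" "t \<le> d * t" using that t(1) by auto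
    ultimately show "d + 2 * t \<le> \<beta> d" "d * (2 * t) \<le> \<beta> d"
      unfolding \<beta>_def distrib_left by linarith+
  qed
  have "conn_cover (common_zeros F G) (\<beta> d)"
  proof (cases "d = 0")
    case True
    then obtain c where "F = [:[:c:]:]" using total_degree_eq_0_iff d_def by metis
    with less.prems have "common_zeros F G = {}" by (auto simp: common_zeros_def)
    then show ?thesis by (simp add: conn_cover_empty)
  next
    case False
    then have d: "d \<ge> 1" by simp
    have nu: "\<not> is_unit F" using False by (simp add: bipoly_is_unit_iff d_def)
    show ?thesis
    proof (cases "irreducible F")
      case True
      consider "degree F = 0" | "F dvd varY" | "degree F \<ge> 1" "\<not> F dvd varY" by linarith
      then show ?thesis
      proof cases
        case 1
        then obtain f where f: "F = [:f:]" by (metis degree_eq_zeroE)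
        with less.prems have "f \<noteq> 0" by auto
        have "degree f \<le> d"
          using degree_coeff_le_total_degree[of F 0] f by (simp add: d_def)
        then have "degree f * (2 * t) \<le> \<beta> d"
          using large(2)[OF d] by (meson mult_le_mono1 order.trans)
        with conn_cover_vertical[OF f \<open>f \<noteq> 0\<close> t] show ?thesis by (rule conn_cover_mono)
      next
        case 2
        from conn_cover_horizontal[OF this t] large(1)[OF d] show ?thesis
          unfolding d_def by (rule conn_cover_mono)
      next
        case 3
        from conn_cover_irreducible[OF True this t] show ?thesis
          unfolding \<beta>_def d_def .
      qed
    next
      case False
      then obtain A B where AB: "F = A * B" "\<not> is_unit A" "\<not> is_unit B"
        using less.prems nu by (auto simp: irreducible_def)
      with less.prems have nz: "A \<noteq> 0" "B \<noteq> 0" by auto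
      have deg: "total_degree A \<ge> 1" "total_degree B \<ge> 1"
        using AB nz by (auto simp: bipoly_is_unit_iff Suc_le_eq)
      have dsum: "d = total_degree A + total_degree B"
        unfolding d_def AB(1) by (rule total_degree_mult[OF nz])
      have "common_zeros F G = common_zeros A G \<union> common_zeros B G"
        unfolding AB(1) by (auto simp: common_zeros_def)
      moreover have "conn_cover (common_zeros A G) (\<beta> (total_degree A))"
        "conn_cover (common_zeros B G) (\<beta> (total_degree B))"
        unfolding \<beta>_def using less.hyps nz deg dsum by (auto simp: d_def)
      ultimately have "conn_cover (common_zeros F G) (\<beta> (total_degree A) + \<beta> (total_degree B))"
        by (simp add: conn_cover_Un)
      \<comment> \<open>Cubes and squares are superadditive, so the bounds of the two factors add up
        within the bound for the product.\<close>
      moreover have "\<beta> a + \<beta> b \<le> \<beta> (a + b)" for a b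
      proof -
        have "a ^ 3 + b ^ 3 \<le> (a + b) ^ 3" "a ^ 2 + b ^ 2 \<le> (a + b) ^ 2"
          by (simp_all add: power2_eq_square power3_eq_cube algebra_simps)
        from mult_right_mono[OF this(1), of t] mult_right_mono[OF this(2), of "t ^ 3"]
        show ?thesis unfolding \<beta>_def by (simp add: algebra_simps)
      qed
      ultimately show ?thesis unfolding dsum by (rule conn_cover_mono)
    qed
  qed
  then show ?case by (simp add: \<beta>_def d_def)
qed

theorem theorem15:
  "\<exists>C::real. C > 0 \<and>
    (\<forall>(d::nat) (t::nat) (F::real poly poly) (G::real poly poly).
      t \<ge> 1 \<longrightarrow> F \<noteq> 0 \<longrightarrow> total_degree F = d \<longrightarrow> t_sparse t G \<longrightarrow>
      (let S = {(x::real, y::real). bipoly_eval F x y = 0 \<and> bipoly_eval G x y = 0}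
       in finite (components S) \<and>
          real (card (components S)) \<le> C * (real d ^ 3 * real t + real d ^ 2 * real t ^ 3)))"
proof (intro exI[of _ 7] conjI allI impI)
  fix d t :: nat and F G :: "real poly poly"
  assume "t \<ge> 1" "F \<noteq> 0" "total_degree F = d" "t_sparse t G"
  then have cover: "conn_cover (common_zeros F G) (7 * (d ^ 3 * t + d ^ 2 * t ^ 3))"
    using conn_cover_common_zeros by blast
  have "real (card (components (common_zeros F G))) \<le> real (7 * (d ^ 3 * t + d ^ 2 * t ^ 3))"
    using conn_cover_components(2)[OF cover] by (rule of_nat_mono)
  then show "let S = {(x, y). bipoly_eval F x y = 0 \<and> bipoly_eval G x y = 0}
       in finite (components S) \<and>
          real (card (components S)) \<le> 7 * (real d ^ 3 * real t + real d ^ 2 * real t ^ 3)"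
    using conn_cover_components(1)[OF cover] by (simp add: common_zeros_def Let_def)
qed simp

end
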